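(* Let $n\ge2$ and let $(M_p)_{p\in\mathbb{N}}$ be a sequence of positive reals with $M_0=1$ satisfying $(M.1)$, $(M.2)'$ and $(M.3)'$. Let $\ast$ be $\{M_p\}$ (Roumieu case) or $(M_p)$ (Beurling case). An ultradistribution $f\in{\mathcal{D}^\ast}'(\mathbb{R}^n)$ is rotation invariant if and only if $f=f_S$, where $f_S$ is the spherical mean of $f$.
   Context: Conditions on the sequence: $(M.1)$: $M_p^2\le M_{p-1}M_{p+1}$ for $p\ge1$. $(M.2)'$: there are $A,H>0$ with $M_{p+1}\le AH^pM_p$ for all $p\in\mathbb{N}$. $(M.3)'$ (non-quasianalyticity): $\sum_{p=1}^\infty M_{p-1}/M_p<\infty$. Spaces. For $K\Subset\mathbb{R}^n$ (a compact subset with non-empty interior) and $h>0$, $\mathcal{D}^{\{M_p\},h}_K$ is the space of $\varphi\in C^\infty(\mathbb{R}^n)$ with support in $K$ and $\|\varphi\|_{\mathcal{E}^{\{M_p\},h}(K)}=\sup_{x\in K,\alpha\in\mathbb{N}^n}\frac{|\varphi^{(\alpha)}(x)|}{h^{|\alpha|}M_{|\alpha|}}<\infty$. Then $\mathcal{D}^{\{M_p\}}(\mathbb{R}^n)=\varinjlim_{K\Subset\mathbb{R}^n}\varinjlim_{h\to\infty}\mathcal{D}^{\{M_p\},h}_K$ and $\mathcal{D}^{(M_p)}(\mathbb{R}^n)=\varinjlim_{K\Subset\mathbb{R}^n}\varprojlim_{h\to0^+}\mathcal{D}^{\{M_p\},h}_K$; ${\mathcal{D}^\ast}'(\mathbb{R}^n)$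 is the topological dual. Rotation invariance: $f\in{\mathcal{D}^\ast}'(\mathbb{R}^n)$ is rotation invariant if $\langle f(x),\varphi(x)\rangle=\langle f(x),\varphi(T^{-1}x)\rangle$ for every $T\in SO(n)$ and every $\varphi\in\mathcal{D}^\ast(\mathbb{R}^n)$. Spherical mean: for $\varphi\in\mathcal{D}^\ast(\mathbb{R}^n)$, $\varphi_S(x)=\frac{1}{|\mathbb{S}^{n-1}|}\int_{\mathbb{S}^{n-1}}\varphi(|x|\omega)\,d\omega=\int_{SO(n)}\varphi(Tx)\,dT$ ($d\omega$ surface measure, $dT$ normalized Haar measure); the map $\varphi\mapsto\varphi_S$ is continuous from $\mathcal{D}^\ast(\mathbb{R}^n)$ into itself. The spherical mean $f_S\in{\mathcal{D}^\ast}'(\mathbb{R}^n)$ of $f$ is defined by $\langle f_S,\varphi\rangle=\langle f,\varphi_S\rangle$. *)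

theory Defs
  imports "HOL-Analysis.Analysis"
begin

definition log_convex_seq :: "(nat \<Rightarrow> real) \<Rightarrow> bool" where
  "log_convex_seq M \<longleftrightarrow> (\<forall>p\<ge>1. (M p)\<^sup>2 \<le> M (p - 1) * M (p + 1))"

definition derivation_stable_seq :: "(nat \<Rightarrow> real) \<Rightarrow> bool" where
  "derivation_stable_seq M \<longleftrightarrow> (\<exists>A>0. \<exists>H>0. \<forall>p. M (p + 1) \<le> A * H ^ p * M p)"

text \<open>The series over \<open>p \<ge> 1\<close> of \<open>M (p - 1) / M p\<close>, with the index shifted by one.\<close>

definition non_quasianalytic_seq :: "(nat \<Rightarrow> real) \<Rightarrow> bool" where
  "non_quasianalytic_seq M \<longleftrightarrow> summable (\<lambda>p. M p / M (p + 1))"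

definition partial_deriv :: "'n::finite \<Rightarrow> (real^'n \<Rightarrow> complex) \<Rightarrow> (real^'n \<Rightarrow> complex)" where
  "partial_deriv i \<phi> = (\<lambda>x. frechet_derivative \<phi> (at x) (axis i 1))"

text \<open>A list of coordinates stands for the iterated partial derivative in these directions.
  A function is \<open>C\<^sup>\<infinity>\<close> iff all its iterated partial derivatives exist and are
  differentiable (hence continuous).\<close>

definition smooth_fun :: "(real^'n \<Rightarrow> complex) \<Rightarrow> bool" where
  "smooth_fun \<phi> \<longleftrightarrow> (\<forall>is. \<forall>x. fold partial_deriv is \<phi> differentiable (at x))"

definition multi_order :: "nat^'n \<Rightarrow> nat" where
  "multi_order \<alpha> = (\<Sum>i\<in>UNIV. \<alpha> $ i)"

text \<open>The index type carries no order, so some order of differentiation is chosen in which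
  every coordinate \<open>i\<close> occurs \<open>\<alpha> $ i\<close> times; by the symmetry of mixed partial derivatives the choice
  is irrelevant for smooth functions, the only ones to which the operator is applied below.\<close>

definition multi_deriv :: "nat^'n \<Rightarrow> (real^'n \<Rightarrow> complex) \<Rightarrow> (real^'n \<Rightarrow> complex)" where
  "multi_deriv \<alpha> \<phi> = fold partial_deriv (SOME is. \<forall>i. count_list is i = \<alpha> $ i) \<phi>"

text \<open>A locally convex space of complex-valued functions (with pointwise operations) is given by
  its topology, whose \<open>topspace\<close> is the underlying vector space. In the inductive limit over an
  increasing family, the absolutely convex sets that are neighbourhoods of zero in every step
  form a base of neighbourhoods of zero; this is the finest locally convex topology that makes
  all the inclusions continuous.\<close>

definition absolutely_convex :: "('a \<Rightarrow> complex) set \<Rightarrow> bool" where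
  "absolutely_convex V \<longleftrightarrow>
     (\<forall>\<phi>\<in>V. \<forall>\<psi>\<in>V. \<forall>a b. norm a + norm b \<le> 1 \<longrightarrow> (\<lambda>x. a * \<phi> x + b * \<psi> x) \<in> V)"

definition ind_lim_nbhd ::
    "'i set \<Rightarrow> ('i \<Rightarrow> ('a \<Rightarrow> complex) topology) \<Rightarrow> ('a \<Rightarrow> complex) set \<Rightarrow> bool" where
  "ind_lim_nbhd I T V \<longleftrightarrow>
     V \<subseteq> (\<Union>i\<in>I. topspace (T i)) \<and> absolutely_convex V \<and>
     (\<forall>i\<in>I. \<exists>U. openin (T i) U \<and> (\<lambda>x. 0) \<in> U \<and> U \<subseteq> V)"

definition ind_lim :: "'i set \<Rightarrow> ('i \<Rightarrow> ('a \<Rightarrow> complex) topology) \<Rightarrow> ('a \<Rightarrow> complex) topology" where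
  "ind_lim I T = topology (\<lambda>W. W \<subseteq> (\<Union>i\<in>I. topspace (T i)) \<and>
     (\<forall>\<phi>\<in>W. \<exists>V. ind_lim_nbhd I T V \<and> (\<forall>\<psi>\<in>V. (\<lambda>x. \<phi> x + \<psi> x) \<in> W)))"

lemma openin_ind_lim:
  "openin (ind_lim I T) W \<longleftrightarrow> W \<subseteq> (\<Union>i\<in>I. topspace (T i)) \<and>
     (\<forall>\<phi>\<in>W. \<exists>V. ind_lim_nbhd I T V \<and> (\<forall>\<psi>\<in>V. (\<lambda>x. \<phi> x + \<psi> x) \<in> W))"
proof -
  let ?P = "\<lambda>W. W \<subseteq> (\<Union>i\<in>I. topspace (T i)) \<and>
     (\<forall>\<phi>\<in>W. \<exists>V. ind_lim_nbhd I T V \<and> (\<forall>\<psi>\<in>V. (\<lambda>x. \<phi> x + \<psi> x) \<in> W))"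
  have inter: "ind_lim_nbhd I T (V \<inter> V')" if "ind_lim_nbhd I T V" "ind_lim_nbhd I T V'" for V V'
    unfolding ind_lim_nbhd_def
  proof (intro conjI ballI)
    show "V \<inter> V' \<subseteq> (\<Union>i\<in>I. topspace (T i))" "absolutely_convex (V \<inter> V')"
      using that by (auto simp: ind_lim_nbhd_def absolutely_convex_def)
  next
    fix i assume "i \<in> I"
    then have "\<exists>U. openin (T i) U \<and> (\<lambda>x. 0) \<in> U \<and> U \<subseteq> V"
      "\<exists>U. openin (T i) U \<and> (\<lambda>x. 0) \<in> U \<and> U \<subseteq> V'"
      using that unfolding ind_lim_nbhd_def by blast+
    then obtain U U' where "openin (T i) U" "(\<lambda>x. 0) \<in> U" "U \<subseteq> V"
      "openin (T i) U'" "(\<lambda>x. 0) \<in> U'" "U' \<subseteq> V'"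
      by blast
    then show "\<exists>U. openin (T i) U \<and> (\<lambda>x. 0) \<in> U \<and> U \<subseteq> V \<inter> V'"
      by (intro exI[of _ "U \<inter> U'"]) auto
  qed
  have "istopology ?P"
    unfolding istopology_def
  proof (intro conjI allI impI)
    fix S S' assume S: "?P S" and S': "?P S'"
    show "S \<inter> S' \<subseteq> (\<Union>i\<in>I. topspace (T i))" using S by blast
    show "\<forall>\<phi>\<in>S \<inter> S'. \<exists>V. ind_lim_nbhd I T V \<and> (\<forall>\<psi>\<in>V. (\<lambda>x. \<phi> x + \<psi> x) \<in> S \<inter> S')"
    proof
      fix \<phi> assume \<phi>: "\<phi> \<in> S \<inter> S'"
      obtain V where V: "ind_lim_nbhd I T V" "\<forall>\<psi>\<in>V. (\<lambda>x. \<phi> x + \<psi> x) \<in> S"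
        using S \<phi> by blast
      obtain V' where V': "ind_lim_nbhd I T V'" "\<forall>\<psi>\<in>V'. (\<lambda>x. \<phi> x + \<psi> x) \<in> S'"
        using S' \<phi> by blast
      show "\<exists>V. ind_lim_nbhd I T V \<and> (\<forall>\<psi>\<in>V. (\<lambda>x. \<phi> x + \<psi> x) \<in> S \<inter> S')"
        using inter[OF V(1) V'(1)] V(2) V'(2) by (intro exI[of _ "V \<inter> V'"]) auto
    qed
  next
    fix \<K> assume K: "\<forall>W\<in>\<K>. ?P W"
    show "\<Union>\<K> \<subseteq> (\<Union>i\<in>I. topspace (T i))" using K by blast
    show "\<forall>\<phi>\<in>\<Union>\<K>. \<exists>V. ind_lim_nbhd I T V \<and> (\<forall>\<psi>\<in>V. (\<lambda>x. \<phi> x + \<psi> x) \<in> \<Union>\<K>)"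
      using K by (meson UnionE UnionI)
  qed
  then show ?thesis
    unfolding ind_lim_def by (simp add: topology_inverse')
qed

text \<open>The coarsest topology on the intersection that makes all the inclusions continuous.\<close>

definition proj_lim :: "'i set \<Rightarrow> ('i \<Rightarrow> ('a \<Rightarrow> complex) topology) \<Rightarrow> ('a \<Rightarrow> complex) topology" where
  "proj_lim I T = topology_generated_by
     {(\<Inter>j\<in>I. topspace (T j)) \<inter> U | i U. i \<in> I \<and> openin (T i) U}"

definition ultra_quotient ::
    "(nat \<Rightarrow> real) \<Rightarrow> real \<Rightarrow> (real^'n \<Rightarrow> complex) \<Rightarrow> (real^'n) \<times> (nat^'n) \<Rightarrow> real" where
  "ultra_quotient M h \<phi> =
     (\<lambda>(x, \<alpha>). norm (multi_deriv \<alpha> \<phi> x) / (h ^ multi_order \<alpha> * M (multi_order \<alpha>)))"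

definition ultra_norm ::
    "(nat \<Rightarrow> real) \<Rightarrow> real \<Rightarrow> (real^'n) set \<Rightarrow> (real^'n \<Rightarrow> complex) \<Rightarrow> real" where
  "ultra_norm M h K \<phi> = (SUP p \<in> K \<times> UNIV. ultra_quotient M h \<phi> p)"

definition test_step ::
    "(nat \<Rightarrow> real) \<Rightarrow> real \<Rightarrow> (real^'n) set \<Rightarrow> (real^'n \<Rightarrow> complex) set" where
  "test_step M h K = {\<phi>. smooth_fun \<phi> \<and> closure {x. \<phi> x \<noteq> 0} \<subseteq> K \<and>
     bdd_above (ultra_quotient M h \<phi> ` (K \<times> UNIV))}"

text \<open>The distance is cut off outside the space because the axioms of \<open>Metric_space\<close> ask for
  nonnegativity and symmetry everywhere, whereas the supremum of an unbounded set is unspecified.\<close>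

definition test_step_dist ::
    "(nat \<Rightarrow> real) \<Rightarrow> real \<Rightarrow> (real^'n) set \<Rightarrow>
     (real^'n \<Rightarrow> complex) \<Rightarrow> (real^'n \<Rightarrow> complex) \<Rightarrow> real" where
  "test_step_dist M h K \<phi> \<psi> = (if \<phi> \<in> test_step M h K \<and> \<psi> \<in> test_step M h K
     then ultra_norm M h K (\<lambda>x. \<phi> x - \<psi> x) else 0)"

definition test_step_topology ::
    "(nat \<Rightarrow> real) \<Rightarrow> real \<Rightarrow> (real^'n) set \<Rightarrow> (real^'n \<Rightarrow> complex) topology" where
  "test_step_topology M h K =
     Metric_space.mtopology (test_step M h K) (test_step_dist M h K)"

datatype ultra_class = Roumieu | Beurling

definition test_compact_topology ::
    "ultra_class \<Rightarrow> (nat \<Rightarrow> real) \<Rightarrow> (real^'n) set \<Rightarrow> (real^'n \<Rightarrow> complex) topology" where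
  "test_compact_topology c M K = (case c of
       Roumieu \<Rightarrow> ind_lim {0<..} (\<lambda>h. test_step_topology M h K)
     | Beurling \<Rightarrow> proj_lim {0<..} (\<lambda>h. test_step_topology M h K))"

definition test_topology :: "ultra_class \<Rightarrow> (nat \<Rightarrow> real) \<Rightarrow> (real^'n \<Rightarrow> complex) topology" where
  "test_topology c M =
     ind_lim {K. compact K \<and> interior K \<noteq> {}} (\<lambda>K. test_compact_topology c M K)"

definition test_space :: "ultra_class \<Rightarrow> (nat \<Rightarrow> real) \<Rightarrow> (real^'n \<Rightarrow> complex) set" where
  "test_space c M = topspace (test_topology c M)"

text \<open>Functionals are made \<open>undefined\<close> outside the test space, so that equality in the dual is
  equality in HOL.\<close>

definition ultradistributions ::
    "ultra_class \<Rightarrow> (nat \<Rightarrow> real) \<Rightarrow> ((real^'n \<Rightarrow> complex) \<Rightarrow> complex) set" where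
  "ultradistributions c M = {f \<in> extensional (test_space c M).
     (\<forall>\<phi>\<in>test_space c M. \<forall>\<psi>\<in>test_space c M. f (\<lambda>x. \<phi> x + \<psi> x) = f \<phi> + f \<psi>) \<and>
     (\<forall>\<phi>\<in>test_space c M. \<forall>a. f (\<lambda>x. a * \<phi> x) = a * f \<phi>) \<and>
     continuous_map (test_topology c M) euclidean f}"

definition rotation_invariant ::
    "ultra_class \<Rightarrow> (nat \<Rightarrow> real) \<Rightarrow> ((real^'n \<Rightarrow> complex) \<Rightarrow> complex) \<Rightarrow> bool" where
  "rotation_invariant c M f \<longleftrightarrow> (\<forall>T. rotation_matrix T \<longrightarrow>
     (\<forall>\<phi>\<in>test_space c M. f \<phi> = f (\<lambda>x. \<phi> (matrix_inv T *v x))))"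

text \<open>Surface measure from polar coordinates: the measure of a Borel set \<open>A\<close> of unit vectors is
  the dimension times the Lebesgue measure of the cone of all \<open>r *\<^sub>R \<omega>\<close> with
  \<open>0 < r \<le> 1\<close> and \<open>\<omega> \<in> A\<close>, which is the preimage of \<open>A\<close> under \<open>sgn x = x /\<^sub>R norm x\<close> in the
  punctured unit ball.\<close>

definition surface_measure :: "(real^'n) measure" where
  "surface_measure = scale_measure (of_nat CARD('n))
     (distr (restrict_space lborel (cball 0 1 - {0})) (restrict_space borel (sphere 0 1)) sgn)"

definition spherical_mean :: "(real^'n \<Rightarrow> complex) \<Rightarrow> (real^'n \<Rightarrow> complex)" where
  "spherical_mean \<phi> = (\<lambda>x. (1 / measure surface_measure (sphere (0::real^'n) 1)) *\<^sub>R
     (\<integral>\<omega>. \<phi> (norm x *\<^sub>R \<omega>) \<partial>surface_measure))"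

definition spherical_mean_dual ::
    "ultra_class \<Rightarrow> (nat \<Rightarrow> real) \<Rightarrow> ((real^'n \<Rightarrow> complex) \<Rightarrow> complex) \<Rightarrow>
     ((real^'n \<Rightarrow> complex) \<Rightarrow> complex)" where
  "spherical_mean_dual c M f = restrict (\<lambda>\<phi>. f (spherical_mean \<phi>)) (test_space c M)"

lemma smooth_fun_differentiable:
  "smooth_fun \<phi> \<Longrightarrow> fold partial_deriv is \<phi> differentiable (at x)"
  by (simp add: smooth_fun_def)

lemma partial_deriv_diff:
  assumes "\<And>x. \<phi> differentiable (at x)" "\<And>x. \<psi> differentiable (at x)"
  shows "partial_deriv i (\<lambda>x. \<phi> x - \<psi> x) = (\<lambda>x. partial_deriv i \<phi> x - partial_deriv i \<psi> x)"
proof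
  fix x
  have "((\<lambda>x. \<phi> x - \<psi> x) has_derivative
      (\<lambda>v. frechet_derivative \<phi> (at x) v - frechet_derivative \<psi> (at x) v)) (at x)"
    using assms by (intro has_derivative_diff) (simp_all flip: frechet_derivative_works)
  then show "partial_deriv i (\<lambda>x. \<phi> x - \<psi> x) x = partial_deriv i \<phi> x - partial_deriv i \<psi> x"
    unfolding partial_deriv_def by (simp flip: frechet_derivative_at)
qed

lemma fold_partial_deriv_diff:
  assumes "smooth_fun \<phi>" "smooth_fun \<psi>"
  shows "fold partial_deriv is (\<lambda>x. \<phi> x - \<psi> x) =
    (\<lambda>x. fold partial_deriv is \<phi> x - fold partial_deriv is \<psi> x)"
proof (induction "is" rule: rev_induct)
  case (snoc i "is")
  then show ?case
    using partial_deriv_diff[of "fold partial_deriv is \<phi>" "fold partial_deriv is \<psi>" i]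
      smooth_fun_differentiable assms by auto
qed simp

lemma multi_deriv_diff:
  assumes "smooth_fun \<phi>" "smooth_fun \<psi>"
  shows "multi_deriv \<alpha> (\<lambda>x. \<phi> x - \<psi> x) x = multi_deriv \<alpha> \<phi> x - multi_deriv \<alpha> \<psi> x"
  unfolding multi_deriv_def fold_partial_deriv_diff[OF assms] ..

lemma multi_deriv_zero: "multi_deriv (0 :: nat^'n) \<phi> = \<phi>"
proof -
  have "(\<forall>i. count_list is i = (0::nat^'n) $ i) \<longleftrightarrow> is = []" for "is" :: "'n list"
    by (cases "is") (auto simp: count_list_0_iff)
  then show ?thesis unfolding multi_deriv_def by (simp del: zero_index)
qed

lemma Metric_space_test_step:
  fixes K :: "(real^'n) set"
  assumes "\<And>p. M p > 0" "h > 0" "K \<noteq> {}"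
  shows "Metric_space (test_step M h K) (test_step_dist M h K)"
proof -
  let ?E = "test_step M h K" and ?d = "\<lambda>\<phi> \<psi>. ultra_norm M h K (\<lambda>x. \<phi> x - \<psi> x)"
  let ?q = "\<lambda>\<phi> \<psi>. ultra_quotient M h (\<lambda>x. \<phi> x - \<psi> x)"
  have w: "h ^ multi_order \<alpha> * M (multi_order \<alpha>) > 0" for \<alpha> :: "nat^'n"
    using assms by simp
  have q: "?q \<phi> \<psi> (x, \<alpha>) = norm (multi_deriv \<alpha> \<phi> x - multi_deriv \<alpha> \<psi> x)
      / (h ^ multi_order \<alpha> * M (multi_order \<alpha>))" if "\<phi> \<in> ?E" "\<psi> \<in> ?E" for \<phi> \<psi> x \<alpha>
    using that by (simp add: ultra_quotient_def multi_deriv_diff test_step_def)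
  have tri: "?q \<phi> \<psi> p \<le> ?q \<phi> \<eta> p + ?q \<eta> \<psi> p" if "\<phi> \<in> ?E" "\<psi> \<in> ?E" "\<eta> \<in> ?E" for \<phi> \<psi> \<eta> p
  proof (cases p)
    case (Pair x \<alpha>)
    show ?thesis
      unfolding Pair q[OF that(1,2)] q[OF that(1,3)] q[OF that(3,2)] add_divide_distrib[symmetric]
      using norm_triangle_ineq[of "multi_deriv \<alpha> \<phi> x - multi_deriv \<alpha> \<eta> x"
          "multi_deriv \<alpha> \<eta> x - multi_deriv \<alpha> \<psi> x"] w[of \<alpha>]
      by (intro divide_right_mono) auto
  qed
  have bdd: "bdd_above (?q \<phi> \<psi> ` (K \<times> UNIV))" if "\<phi> \<in> ?E" "\<psi> \<in> ?E" for \<phi> \<psi>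
  proof -
    have "bdd_above (ultra_quotient M h \<phi> ` (K \<times> UNIV))" "bdd_above (ultra_quotient M h \<psi> ` (K \<times> UNIV))"
      using that by (simp_all add: test_step_def)
    then obtain A B where A: "\<And>p. p \<in> K \<times> UNIV \<Longrightarrow> ultra_quotient M h \<phi> p \<le> A"
      and B: "\<And>p. p \<in> K \<times> UNIV \<Longrightarrow> ultra_quotient M h \<psi> p \<le> B"
      by (meson bdd_above.E imageI)
    have "?q \<phi> \<psi> (x, \<alpha>) \<le> A + B" if "x \<in> K" for x \<alpha>
    proof -
      have "?q \<phi> \<psi> (x, \<alpha>) \<le> ultra_quotient M h \<phi> (x, \<alpha>) + ultra_quotient M h \<psi> (x, \<alpha>)"
        unfolding q[OF \<open>\<phi> \<in> ?E\<close> \<open>\<psi> \<in> ?E\<close>] unfolding ultra_quotient_def prod.case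
          add_divide_distrib[symmetric]
        using norm_triangle_ineq4 w[of \<alpha>] by (intro divide_right_mono) auto
      then show ?thesis using A[of "(x, \<alpha>)"] B[of "(x, \<alpha>)"] that by simp
    qed
    then show ?thesis by (intro bdd_aboveI[of _ "A + B"]) auto
  qed
  have le: "?q \<phi> \<psi> p \<le> ?d \<phi> \<psi>" if "\<phi> \<in> ?E" "\<psi> \<in> ?E" "p \<in> K \<times> UNIV" for \<phi> \<psi> p
    unfolding ultra_norm_def by (rule cSUP_upper[OF that(3) bdd[OF that(1,2)]])
  have qnn: "0 \<le> ultra_quotient M h \<phi> p" for \<phi> and p :: "(real^'n) \<times> (nat^'n)"
    using w by (cases p) (auto simp: ultra_quotient_def intro!: divide_nonneg_pos)
  have ne: "K \<times> (UNIV :: (nat^'n) set) \<noteq> {}" using assms by auto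
  have nn: "0 \<le> ?d \<phi> \<psi>" if "\<phi> \<in> ?E" "\<psi> \<in> ?E" for \<phi> \<psi>
    using le[OF that] qnn ne by (meson all_not_in_conv order_trans)
  have sym: "?d \<phi> \<psi> = ?d \<psi> \<phi>" if "\<phi> \<in> ?E" "\<psi> \<in> ?E" for \<phi> \<psi>
    unfolding ultra_norm_def using q[OF that] q[OF that(2,1)]
    by (intro SUP_cong) (auto simp: norm_minus_commute)
  have trid: "?d \<phi> \<psi> \<le> ?d \<phi> \<eta> + ?d \<eta> \<psi>" if "\<phi> \<in> ?E" "\<eta> \<in> ?E" "\<psi> \<in> ?E" for \<phi> \<psi> \<eta>
    unfolding ultra_norm_def[of M h K "\<lambda>x. \<phi> x - \<psi> x"]
  proof (rule cSUP_least[OF ne])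
    fix p :: "(real^'n) \<times> (nat^'n)" assume "p \<in> K \<times> UNIV"
    then show "?q \<phi> \<psi> p \<le> ?d \<phi> \<eta> + ?d \<eta> \<psi>"
      using tri[OF that(1,3,2), of p] le[OF that(1,2), of p] le[OF that(2,3), of p] by linarith
  qed
  have zero: "?d \<phi> \<psi> = 0 \<longleftrightarrow> \<phi> = \<psi>" if "\<phi> \<in> ?E" "\<psi> \<in> ?E" for \<phi> \<psi>
  proof
    assume d0: "?d \<phi> \<psi> = 0"
    show "\<phi> = \<psi>"
    proof
      fix x
      show "\<phi> x = \<psi> x"
      proof (cases "x \<in> K")
        case True
        then have "?q \<phi> \<psi> (x, 0) \<le> 0" using le[OF that, of "(x, 0)"] d0 by simp
        then show ?thesis
          using w[of 0] unfolding q[OF that] multi_deriv_zero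
          by (auto simp: divide_le_0_iff simp del: mult_pos_pos)
      next
        case False
        then have "x \<notin> closure {x. \<phi> x \<noteq> 0}" "x \<notin> closure {x. \<psi> x \<noteq> 0}"
          using that by (auto simp: test_step_def)
        then have "\<phi> x = 0" "\<psi> x = 0"
          using closure_subset[of "{x. \<phi> x \<noteq> 0}"] closure_subset[of "{x. \<psi> x \<noteq> 0}"] by auto
        then show ?thesis by simp
      qed
    qed
  next
    assume eq: "\<phi> = \<psi>"
    have "?q \<phi> \<psi> p = 0" for p using q[OF that] eq by (cases p) simp
    then show "?d \<phi> \<psi> = 0" unfolding ultra_norm_def using assms ne by simp
  qed
  show ?thesis
    by unfold_locales (use nn sym zero trid in \<open>auto simp: test_step_dist_def\<close>)
qed

lemma topspace_test_step_topology:
  fixes K :: "(real^'n) set"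
  assumes "\<And>p. M p > 0" "h > 0" "K \<noteq> {}"
  shows "topspace (test_step_topology M h K) = test_step M h K"
  unfolding test_step_topology_def
  by (rule Metric_space.topspace_mtopology[OF Metric_space_test_step[OF assms]])

lemma space_surface_measure [simp]: "space (surface_measure :: (real^'n) measure) = sphere 0 1"
  by (simp add: surface_measure_def space_scale_measure space_restrict_space)

lemma emeasure_surface_measure:
  fixes A :: "(real^'n) set"
  assumes "A \<in> sets borel" "A \<subseteq> sphere 0 1"
  shows "emeasure surface_measure A =
    of_nat CARD('n) * emeasure lborel {x \<in> cball 0 1 - {0}. sgn x \<in> A}"
proof -
  let ?B = "cball 0 1 - {0} :: (real^'n) set"
  have B: "?B \<in> sets borel" by measurable
  have "sgn \<in> borel_measurable (borel :: (real^'n) measure)"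
    unfolding sgn_div_norm by measurable
  then have m: "sgn \<in> measurable (restrict_space lborel ?B) (restrict_space borel (sphere 0 1))"
    by (intro measurable_restrict_space3) (auto simp: norm_sgn)
  have A: "A \<in> sets (restrict_space borel (sphere 0 1))"
    using assms by (auto simp: sets_restrict_space)
  have "emeasure surface_measure A = of_nat CARD('n) * emeasure (restrict_space lborel ?B) (sgn -` A \<inter> ?B)"
    using m A by (simp add: surface_measure_def emeasure_distr space_restrict_space)
  also have "emeasure (restrict_space lborel ?B) (sgn -` A \<inter> ?B) = emeasure lborel (sgn -` A \<inter> ?B)"
    using B by (intro emeasure_restrict_space) auto
  also have "sgn -` A \<inter> ?B = {x \<in> ?B. sgn x \<in> A}" by blast
  finally show ?thesis .
qed

lemma measure_surface_measure_sphere: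
  "measure surface_measure (sphere 0 1 :: (real^'n) set) =
    real CARD('n) * unit_ball_vol (real CARD('n))"
proof -
  have "{x \<in> cball 0 1 - {0}. sgn x \<in> sphere 0 1} = cball 0 1 - {0 :: real^'n}"
    by (auto simp: norm_sgn)
  moreover have "emeasure lborel (cball 0 1 - {0 :: real^'n}) = emeasure lborel (cball 0 1 :: (real^'n) set)"
    by (rule emeasure_Diff_null_set) auto
  ultimately have "emeasure surface_measure (sphere 0 1 :: (real^'n) set) =
      of_nat CARD('n) * ennreal (unit_ball_vol (real CARD('n)))"
    by (simp add: emeasure_surface_measure emeasure_cball)
  also have "\<dots> = ennreal (real CARD('n) * unit_ball_vol (real CARD('n)))"
    by (simp add: ennreal_mult ennreal_of_nat_eq_real_of_nat)
  finally show ?thesis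
    by (simp add: measure_def)
qed

end

theory Submission
  imports Defs
begin

text \<open>Why the theorem holds. Composition of a test function with a rotation does not change its spherical
mean, because surface measure is rotation invariant; this gives the direction from \<open>f = f\<^sub>S\<close> to
rotation invariance. For the converse, let \<open>f\<close> be rotation invariant. Then \<open>f\<close> takes the same value at
every convex combination of rotated copies of \<open>\<phi>\<close> as at \<open>\<phi>\<close> itself, so it suffices to find such
combinations that converge to the spherical mean of \<open>\<phi>\<close> in the test space. Riemann sums for the Haar
integral over the rotation group would do. Here the group integral is replaced by a minimisation:
among the iterated midpoints of rotated copies of \<open>\<phi>\<close> take a sequence that minimises the
\<open>L\<^sup>2\<close> norm.

By the parallelogram law, two near-minimal averages are close in \<open>L\<^sup>2\<close>
(\<open>near_minimal_rotation_averages_close\<close>). All averages satisfy the same bounds on every derivative,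
so \<open>L\<^sup>2\<close> closeness gives uniform closeness (a function with a large value is large on a ball of fixed
radius), and, by interpolation between a function and its second derivatives, uniform closeness of
all derivatives (\<open>uniform_limit_fold_partial_deriv_0\<close>). Hence the minimising sequence converges
uniformly with all derivatives to a smooth function \<open>\<psi>\<close>. A rotated copy of the minimising
sequence is again minimising, so \<open>\<psi>\<close> is invariant under rotations, that is, radial as \<open>n \<ge> 2\<close>.
The spherical mean is constant along the sequence and continuous for uniform convergence, so
\<open>\<psi>\<close> is the spherical mean of \<open>\<phi>\<close>
(\<open>rotation_averages_approximate_spherical_mean\<close>).

For the topology, a derivative of order \<open>k\<close> of a rotated function is a combination of \<open>n ^ k\<close>
derivatives of order \<open>k\<close> with coefficients of absolute value at most \<open>1\<close>, so rotation takes the step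
of parameter \<open>h\<close> into the step of parameter \<open>n h\<close>. In the step of parameter \<open>2 n h\<close> the derivatives
of high order of an average are negligible, by a factor \<open>2 ^ k\<close>, and only finitely many orders are left,
where uniform convergence suffices (\<open>test_null_sequence_rotation_averages\<close>). Replacing \<open>h\<close> by a
constant multiple is harmless both when some \<open>h\<close> is asked for (Roumieu) and when all \<open>h\<close> are
(Beurling).\<close>

section \<open>Lebesgue measure is invariant under orthogonal maps\<close>

text \<open>An orthogonal map sends a ball to a ball of the same radius, hence of the same volume, and by Vitali's
covering theorem an open set is, up to a null set, a disjoint union of countably many balls.
Only the image of the union is compared, so the image of the null set need not be measured; the
opposite inequality comes from the inverse map.\<close>

lemma emeasure_le_orthogonal_image_open:
  fixes T :: "'a::euclidean_space \<Rightarrow> 'a"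
  assumes T: "orthogonal_transformation T" and S: "open S"
  shows "emeasure lborel S \<le> emeasure lborel (T ` S)"
proof -
  define K where "K = {(a, r). ball a r \<subseteq> S}"
  have cover: "\<exists>i. i \<in> K \<and> x \<in> ball (fst i) (snd i) \<and> snd i < d" if "x \<in> S" "0 < d" for x d
  proof -
    obtain e where e: "e > 0" "ball x e \<subseteq> S" using S \<open>x \<in> S\<close> openE by blast
    have "ball x (min e (d/2)) \<subseteq> S" using e(2) by auto
    then show ?thesis
      using e(1) that by (intro exI[of _ "(x, min e (d/2))"]) (auto simp: K_def)
  qed
  obtain C where C: "countable C" "C \<subseteq> K"
    and disj: "pairwise (\<lambda>i j. disjnt (ball (fst i) (snd i)) (ball (fst j) (snd j))) C"
    and neg: "negligible (S - (\<Union>i\<in>C. ball (fst i) (snd i)))"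
    by (rule Vitali_covering_theorem_balls[OF cover])
  let ?U = "\<Union>i\<in>C. ball (fst i) (snd i)"
  have US: "?U \<subseteq> S" using C(2) unfolding K_def by fastforce
  have Sb: "S \<in> sets borel" using S by simp
  have Ub: "?U \<in> sets borel" by (intro borel_open open_UN) auto
  have N: "S - ?U \<in> null_sets lborel"
    using neg sets.Diff[OF Sb Ub] null_sets_completion_iff[of "S - ?U" lborel] unfolding negligible_iff_null_sets by simp
  have Tball: "T ` ball a r = ball (T a) r" for a r
    by (rule image_orthogonal_transformation_ball[OF T])
  have d1: "disjoint_family_on (\<lambda>i. ball (fst i) (snd i)) C"
    using disj by (auto simp: disjoint_family_on_def pairwise_def disjnt_def)
  have d2: "disjoint_family_on (\<lambda>i. T ` ball (fst i) (snd i)) C"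
    using disj orthogonal_transformation_inj[OF T]
    unfolding disjoint_family_on_def pairwise_def disjnt_def by (simp flip: image_Int)
  have "emeasure lborel S = emeasure lborel ?U"
    using emeasure_Un_null_set[of ?U lborel "S - ?U"] N Ub US by (simp add: Un_absorb1)
  also have "\<dots> = (\<integral>\<^sup>+i. emeasure lborel (ball (fst i) (snd i)) \<partial>count_space C)"
    using C(1) d1 by (intro emeasure_UN_countable) auto
  also have "\<dots> = (\<integral>\<^sup>+i. emeasure lborel (T ` ball (fst i) (snd i)) \<partial>count_space C)"
  proof (intro nn_integral_cong)
    fix i :: "'a \<times> real"
    show "emeasure lborel (ball (fst i) (snd i)) = emeasure lborel (T ` ball (fst i) (snd i))"
      by (cases "snd i \<ge> 0") (simp_all add: Tball emeasure_ball ball_empty)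
  qed
  also have "\<dots> = emeasure lborel (\<Union>i\<in>C. T ` ball (fst i) (snd i))"
    using C(1) d2 by (intro emeasure_UN_countable[symmetric]) (auto simp: Tball)
  also have "\<dots> \<le> emeasure lborel (T ` S)"
  proof (rule emeasure_mono)
    show "(\<Union>i\<in>C. T ` ball (fst i) (snd i)) \<subseteq> T ` S" using US by blast
    have "open (T ` S)"
      using T S by (intro open_surjective_linear_image orthogonal_transformation_linear orthogonal_transformation_surj)
    then show "T ` S \<in> sets lborel" by simp
  qed
  finally show ?thesis .
qed

text \<open>The inequality of the previous lemma, applied to \<open>T\<close> and to its inverse, gives equality on boxes, and
these determine Lebesgue measure.\<close>

lemma lborel_distr_orthogonal:
  fixes T :: "'a::euclidean_space \<Rightarrow> 'a"
  assumes T: "orthogonal_transformation T"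
  shows "distr lborel borel T = lborel"
proof (rule lborel_eqI[symmetric])
  fix l u :: 'a assume le: "\<And>b. b \<in> Basis \<Longrightarrow> l \<bullet> b \<le> u \<bullet> b"
  have lin: "linear T" and bij: "bij T"
    using T orthogonal_transformation_linear orthogonal_transformation_bij by blast+
  have inv: "orthogonal_transformation (inv T)"
    using T by (rule orthogonal_transformation_inv)
  have Tm: "T \<in> borel_measurable borel"
    using lin by (intro borel_measurable_continuous_onI linear_continuous_on) (simp add: linear_conv_bounded_linear)
  have vimage: "T -` box l u = inv T ` box l u"
    using bij by (simp add: bij_vimage_eq_inv_image)
  have "open (inv T ` box l u)"
    using inv by (intro open_surjective_linear_image orthogonal_transformation_linear orthogonal_transformation_surj) auto
  then have "emeasure lborel (inv T ` box l u) \<le> emeasure lborel (T ` inv T ` box l u)"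
    by (rule emeasure_le_orthogonal_image_open[OF T])
  moreover have "T ` inv T ` box l u = box l u"
    using bij by (simp add: image_comp bij_is_surj surj_iff[THEN iffD1])
  ultimately have "emeasure lborel (inv T ` box l u) = emeasure lborel (box l u)"
    using emeasure_le_orthogonal_image_open[OF inv open_box[of l u]] by simp
  then show "emeasure (distr lborel borel T) (box l u) = (\<Prod>b\<in>Basis. (u - l) \<bullet> b)"
    using le Tm by (simp add: emeasure_distr vimage inner_diff_left)
qed simp

section \<open>Calculus of iterated partial derivatives\<close>

lemma partial_deriv_eqI: "(\<phi> has_derivative D) (at x) \<Longrightarrow> partial_deriv i \<phi> x = D (axis i 1)"
  unfolding partial_deriv_def by (simp flip: frechet_derivative_at)

lemma has_derivative_partial_derivs:
  assumes "\<phi> differentiable (at x)"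
  shows "(\<phi> has_derivative (\<lambda>h. \<Sum>i\<in>UNIV. (h $ i) *\<^sub>R partial_deriv i \<phi> x)) (at x)"
proof -
  let ?D = "frechet_derivative \<phi> (at x)"
  have D: "(\<phi> has_derivative ?D) (at x)" using assms frechet_derivative_works by blast
  interpret linear ?D using D has_derivative_linear by blast
  have "?D h = (\<Sum>i\<in>UNIV. (h $ i) *\<^sub>R partial_deriv i \<phi> x)" for h
  proof -
    have "?D h = ?D (\<Sum>i\<in>UNIV. (h $ i) *s axis i 1)" by (simp add: basis_expansion)
    then show ?thesis by (simp add: sum scale partial_deriv_def scalar_mult_eq_scaleR)
  qed
  then have "?D = (\<lambda>h. \<Sum>i\<in>UNIV. (h $ i) *\<^sub>R partial_deriv i \<phi> x)" by blast
  with D show ?thesis by simp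
qed

lemma has_derivative_along_axis:
  assumes "\<And>y. \<phi> differentiable (at y)"
  shows "((\<lambda>s. \<phi> (x + s *\<^sub>R axis i 1)) has_derivative
    (\<lambda>h. h *\<^sub>R partial_deriv i \<phi> (x + s *\<^sub>R axis i 1))) (at s within S)"
proof -
  have "((\<lambda>s. \<phi> (x + s *\<^sub>R axis i 1)) has_derivative
      (\<lambda>h. \<Sum>k\<in>UNIV. ((h *\<^sub>R axis i 1) $ k) *\<^sub>R partial_deriv k \<phi> (x + s *\<^sub>R axis i 1))) (at s within S)"
    by (rule has_derivative_compose[OF _ has_derivative_partial_derivs[OF assms], of "\<lambda>s. x + s *\<^sub>R axis i 1"])
      (auto intro!: derivative_eq_intros)
  then show ?thesis
    by (simp add: axis_def if_distrib[of "\<lambda>z. z *\<^sub>R _"] if_distrib[of "\<lambda>z. _ * z"] cong: if_cong)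
qed

lemma smooth_fun_fold_partial_deriv: "smooth_fun \<phi> \<Longrightarrow> smooth_fun (fold partial_deriv is \<phi>)"
  unfolding smooth_fun_def by (metis comp_apply fold_append)

lemma smooth_fun_partial_deriv: "smooth_fun \<phi> \<Longrightarrow> smooth_fun (partial_deriv i \<phi>)"
  using smooth_fun_fold_partial_deriv[of \<phi> "[i]"] by simp

lemma smooth_fun_imp_differentiable: "smooth_fun \<phi> \<Longrightarrow> \<phi> differentiable (at x)"
  using smooth_fun_differentiable[of \<phi> "[]"] by simp

lemma smooth_fun_imp_continuous_on: "smooth_fun \<phi> \<Longrightarrow> continuous_on S \<phi>"
  by (meson smooth_fun_imp_differentiable continuous_at_imp_continuous_on differentiable_imp_continuous_within)

text \<open>Smoothness is the greatest property that implies differentiability and is inherited by partial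
derivatives. This avoids explicit formulas for higher derivatives of compositions.\<close>

lemma smooth_fun_coinduct:
  assumes "\<phi> \<in> S"
    and "\<And>\<psi> x. \<psi> \<in> S \<Longrightarrow> \<psi> differentiable (at x)"
    and "\<And>\<psi> i. \<psi> \<in> S \<Longrightarrow> partial_deriv i \<psi> \<in> S"
  shows "smooth_fun \<phi>"
proof -
  have "fold partial_deriv is \<psi> \<in> S" if "\<psi> \<in> S" for \<psi> "is"
    using that assms(3) by (induction "is" arbitrary: \<psi>) auto
  then show ?thesis unfolding smooth_fun_def using assms(1,2) by blast
qed

lemma partial_deriv_lincomb:
  assumes "\<phi> differentiable (at x)" "\<psi> differentiable (at x)"
  shows "partial_deriv i (\<lambda>x. a * \<phi> x + b * \<psi> x) x = a * partial_deriv i \<phi> x + b * partial_deriv i \<psi> x"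
    and "(\<lambda>x. a * \<phi> x + b * \<psi> x) differentiable (at x)"
proof -
  have "((\<lambda>x. a * \<phi> x + b * \<psi> x) has_derivative
     (\<lambda>h. a * (\<Sum>i\<in>UNIV. (h $ i) *\<^sub>R partial_deriv i \<phi> x) + b * (\<Sum>i\<in>UNIV. (h $ i) *\<^sub>R partial_deriv i \<psi> x))) (at x)"
    using assms by (intro derivative_intros has_derivative_partial_derivs)
  then show "partial_deriv i (\<lambda>x. a * \<phi> x + b * \<psi> x) x = a * partial_deriv i \<phi> x + b * partial_deriv i \<psi> x"
    "(\<lambda>x. a * \<phi> x + b * \<psi> x) differentiable (at x)"
    by (auto simp: partial_deriv_eqI axis_def if_distrib[of "\<lambda>z. z *\<^sub>R _"] cong: if_cong intro: differentiableI)
qed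

lemma fold_partial_deriv_lincomb:
  assumes "smooth_fun \<phi>" "smooth_fun \<psi>"
  shows "fold partial_deriv is (\<lambda>x. a * \<phi> x + b * \<psi> x) =
    (\<lambda>x. a * fold partial_deriv is \<phi> x + b * fold partial_deriv is \<psi> x)"
  by (induction "is" rule: rev_induct) (auto simp: partial_deriv_lincomb smooth_fun_differentiable assms)

lemma smooth_fun_lincomb:
  assumes "smooth_fun \<phi>" "smooth_fun \<psi>"
  shows "smooth_fun (\<lambda>x. a * \<phi> x + b * \<psi> x)"
  unfolding smooth_fun_def fold_partial_deriv_lincomb[OF assms]
  by (auto intro!: partial_deriv_lincomb(2) smooth_fun_differentiable assms)

lemma smooth_fun_zero: "smooth_fun (\<lambda>x. 0)"
proof (rule smooth_fun_coinduct[of _ "{\<lambda>x. 0}"])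
  show "partial_deriv i \<psi> \<in> {\<lambda>x. 0}" if "\<psi> \<in> {\<lambda>x. 0}" for \<psi> :: "real^'n \<Rightarrow> complex" and i
    using that by (auto simp: partial_deriv_def)
qed auto

lemma fold_partial_deriv_zero: "fold partial_deriv is (\<lambda>x. 0) = (\<lambda>x. 0)"
  by (induction "is") (auto simp: partial_deriv_def)

lemma smooth_fun_sum_partial_derivs:
  assumes "smooth_fun \<phi>" "finite A"
  shows "smooth_fun (\<lambda>x. \<Sum>j\<in>A. c j * partial_deriv j \<phi> x) \<and>
    fold partial_deriv is (\<lambda>x. \<Sum>j\<in>A. c j * partial_deriv j \<phi> x) =
      (\<lambda>x. \<Sum>j\<in>A. c j * fold partial_deriv (j # is) \<phi> x)"
  using assms(2)
proof induction
  case (insert j A)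
  then show ?case
    using smooth_fun_lincomb[OF smooth_fun_partial_deriv[OF assms(1)], of "\<lambda>x. \<Sum>j\<in>A. c j * partial_deriv j \<phi> x" "c j" j 1]
      fold_partial_deriv_lincomb[OF smooth_fun_partial_deriv[OF assms(1)], of "\<lambda>x. \<Sum>j\<in>A. c j * partial_deriv j \<phi> x" "is" "c j" j 1]
    by simp
qed (auto simp: smooth_fun_zero fold_partial_deriv_zero)

lemma partial_deriv_compose_matrix:
  assumes "smooth_fun \<phi>"
  shows "partial_deriv i (\<lambda>x. \<phi> (T *v x)) =
      (\<lambda>x. \<Sum>j\<in>UNIV. of_real (T $ j $ i) * partial_deriv j \<phi> (T *v x))"
    and "(\<lambda>x. \<phi> (T *v x)) differentiable (at x)"
proof -
  have D: "((\<lambda>x. \<phi> (T *v x)) has_derivative (\<lambda>h. \<Sum>j\<in>UNIV. ((T *v h) $ j) *\<^sub>R partial_deriv j \<phi> (T *v x))) (at x)" for x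
    by (rule has_derivative_compose[OF _ has_derivative_partial_derivs, of "\<lambda>x. T *v x"])
      (auto intro: bounded_linear_imp_has_derivative matrix_vector_mul_bounded_linear
        smooth_fun_imp_differentiable assms)
  show "partial_deriv i (\<lambda>x. \<phi> (T *v x)) =
      (\<lambda>x. \<Sum>j\<in>UNIV. of_real (T $ j $ i) * partial_deriv j \<phi> (T *v x))"
    by (auto simp: partial_deriv_eqI[OF D] matrix_vector_mult_basis column_def scaleR_conv_of_real)
  show "(\<lambda>x. \<phi> (T *v x)) differentiable (at x)" using D by (auto intro: differentiableI)
qed

text \<open>The compositions of smooth functions with \<open>T\<close> are closed under partial differentiation: by the chain
rule the new outer function is again a combination of partial derivatives of the old one.\<close>

lemma smooth_fun_compose_matrix:
  fixes T :: "real^'n^'m"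
  assumes "smooth_fun \<phi>"
  shows "smooth_fun (\<lambda>x. \<phi> (T *v x))"
proof (rule smooth_fun_coinduct[of _ "(\<lambda>\<psi> x. \<psi> (T *v x)) ` Collect smooth_fun"])
  fix \<psi> and x :: "real^'n" and i
  assume "\<psi> \<in> (\<lambda>\<psi> x. \<psi> (T *v x)) ` Collect smooth_fun"
  then obtain \<eta> where \<eta>: "\<psi> = (\<lambda>x. \<eta> (T *v x))" "smooth_fun \<eta>" by blast
  show "\<psi> differentiable (at x)" unfolding \<eta>(1) by (rule partial_deriv_compose_matrix(2)[OF \<eta>(2)])
  show "partial_deriv i \<psi> \<in> (\<lambda>\<psi> x. \<psi> (T *v x)) ` Collect smooth_fun"
    using smooth_fun_sum_partial_derivs[OF \<eta>(2), of UNIV "\<lambda>j. of_real (T $ j $ i)"]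
    unfolding \<eta>(1) partial_deriv_compose_matrix(1)[OF \<eta>(2)]
    by (intro image_eqI[of _ _ "\<lambda>y. \<Sum>j\<in>UNIV. of_real (T $ j $ i) * partial_deriv j \<eta> y"]) auto
qed (use assms in blast)

text \<open>Each of the \<open>length is\<close> differentiations replaces one derivative by a sum of \<open>CARD('m)\<close> of them. The
resulting geometric factor is what moves a rotated test function to another step parameter.\<close>

lemma norm_fold_partial_deriv_compose_matrix_le:
  fixes T :: "real^'n^'m"
  assumes "smooth_fun \<phi>" and T: "\<And>i j. \<bar>T $ j $ i\<bar> \<le> 1"
    and "\<And>js x. length js = length is \<Longrightarrow> norm (fold partial_deriv js \<phi> x) \<le> B"
  shows "norm (fold partial_deriv is (\<lambda>x. \<phi> (T *v x)) x) \<le> real CARD('m) ^ length is * B"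
  using assms(1,3)
proof (induction "is" arbitrary: \<phi> B)
  case Nil
  then show ?case by simp
next
  case (Cons i "is")
  define \<phi>' where "\<phi>' = (\<lambda>y. \<Sum>j\<in>UNIV. of_real (T $ j $ i) * partial_deriv j \<phi> y)"
  have s: "smooth_fun \<phi>'" and f: "fold partial_deriv js \<phi>' =
      (\<lambda>x. \<Sum>j\<in>UNIV. of_real (T $ j $ i) * fold partial_deriv (j # js) \<phi> x)" for js
    using smooth_fun_sum_partial_derivs[OF Cons.prems(1), of UNIV "\<lambda>j. of_real (T $ j $ i)"]
    by (auto simp: \<phi>'_def)
  have "norm (fold partial_deriv js \<phi>' x) \<le> real CARD('m) * B" if "length js = length is" for js x
  proof -
    have "norm (of_real (T $ j $ i) * fold partial_deriv (j # js) \<phi> x) \<le> B" for j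
      using mult_mono[OF T[of j i] Cons.prems(2)[of "j # js" x]] that by (simp add: norm_mult)
    then show ?thesis unfolding f by (intro sum_norm_bound[THEN order_trans]) auto
  qed
  from Cons.IH[OF s this]
  have "norm (fold partial_deriv is (\<lambda>x. \<phi>' (T *v x)) x) \<le> real CARD('m) ^ length is * (real CARD('m) * B)"
    by blast
  then show ?case
    by (simp add: partial_deriv_compose_matrix(1)[OF Cons.prems(1)] \<phi>'_def mult_ac)
qed

lemma fold_partial_deriv_eq_0_on_open:
  assumes "open U" "\<And>x. x \<in> U \<Longrightarrow> \<phi> x = 0" "x \<in> U"
  shows "fold partial_deriv is \<phi> x = 0"
  using assms(3)
proof (induction "is" arbitrary: x rule: rev_induct)
  case (snoc i "is")
  have "(fold partial_deriv is \<phi> has_derivative (\<lambda>h. 0)) (at x)"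
    by (rule has_derivative_transform_within_open[OF has_derivative_const[of 0] assms(1) snoc.prems])
      (simp add: snoc.IH)
  then show ?case by (simp add: partial_deriv_eqI)
qed (use assms in simp)

text \<open>The mean value inequality is applied to a difference of \<open>\<phi>\<close> along one axis, whose derivative is a
difference of values of \<open>partial_deriv i \<phi>\<close> near \<open>x\<close> and is controlled by its differentiability at
\<open>x\<close>. The second difference being symmetric in \<open>i\<close> and \<open>j\<close>, this gives the
symmetry of mixed partial derivatives.\<close>

lemma second_difference_approx:
  fixes \<phi> :: "real^'n \<Rightarrow> complex"
  assumes \<phi>: "\<And>y. \<phi> differentiable (at y)" and d\<phi>: "partial_deriv i \<phi> differentiable (at x)" and "e > 0"
  shows "\<exists>d>0. \<forall>t. 0 < t \<and> t < d \<longrightarrow>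
    norm (\<phi> (x + t *\<^sub>R axis i 1 + t *\<^sub>R axis j 1) - \<phi> (x + t *\<^sub>R axis i 1) - \<phi> (x + t *\<^sub>R axis j 1) + \<phi> x
      - t\<^sup>2 *\<^sub>R partial_deriv j (partial_deriv i \<phi>) x) \<le> e * t\<^sup>2"
proof -
  define L where "L = (\<lambda>h. \<Sum>k\<in>UNIV. (h $ k) *\<^sub>R partial_deriv k (partial_deriv i \<phi>) x)"
  have D: "(partial_deriv i \<phi> has_derivative L) (at x)"
    unfolding L_def by (rule has_derivative_partial_derivs[OF d\<phi>])
  interpret L: linear L using D has_derivative_linear by blast
  have Lj: "L (axis j 1) = partial_deriv j (partial_deriv i \<phi>) x"
    using partial_deriv_eqI[OF D, of j] by simp
  obtain d where d: "d > 0" "\<And>y. norm (y - x) < d \<Longrightarrow>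
      norm (partial_deriv i \<phi> y - partial_deriv i \<phi> x - L (y - x)) \<le> (e/3) * norm (y - x)"
    using D \<open>e > 0\<close> unfolding has_derivative_at_alt by (metis divide_pos_pos zero_less_numeral)
  \<comment> \<open>The bound \<open>e / 3\<close> is used at two points, at distances at most \<open>2 * t\<close> and \<open>t\<close> from \<open>x\<close>.\<close>
  let ?ei = "axis i 1 :: real^'n" and ?ej = "axis j 1 :: real^'n"
  have "norm (\<phi> (x + t *\<^sub>R ?ei + t *\<^sub>R ?ej) - \<phi> (x + t *\<^sub>R ?ei) - \<phi> (x + t *\<^sub>R ?ej) + \<phi> x
      - t\<^sup>2 *\<^sub>R partial_deriv j (partial_deriv i \<phi>) x) \<le> e * t\<^sup>2" if t: "0 < t" "t < d/2" for t
  proof -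
    define G where "G s = \<phi> (x + s *\<^sub>R ?ei + t *\<^sub>R ?ej) - \<phi> (x + s *\<^sub>R ?ei) - (s * t) *\<^sub>R L ?ej" for s
    define G' where "G' s = partial_deriv i \<phi> (x + s *\<^sub>R ?ei + t *\<^sub>R ?ej) - partial_deriv i \<phi> (x + s *\<^sub>R ?ei)
      - t *\<^sub>R L ?ej" for s
    have "(G has_derivative (\<lambda>h. h *\<^sub>R G' s)) (at s within {0..t})" for s
      unfolding G_def G'_def
      using has_derivative_along_axis[OF \<phi>, of "x + t *\<^sub>R ?ej" i s "{0..t}"] has_derivative_along_axis[OF \<phi>, of x i s "{0..t}"]
      by (auto intro!: derivative_eq_intros simp: add_ac algebra_simps)
    moreover have "onorm (\<lambda>h. h *\<^sub>R G' s) \<le> e * t" if "s \<in> {0..t}" for s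
    proof -
      have ne: "norm (s *\<^sub>R ?ei + t *\<^sub>R ?ej) \<le> s + t" "norm (s *\<^sub>R ?ei) = s"
        using that t norm_triangle_ineq[of "s *\<^sub>R ?ei" "t *\<^sub>R ?ej"] by auto
      then have "norm (partial_deriv i \<phi> (x + (s *\<^sub>R ?ei + t *\<^sub>R ?ej)) - partial_deriv i \<phi> x - L (s *\<^sub>R ?ei + t *\<^sub>R ?ej))
          \<le> (e/3) * norm (s *\<^sub>R ?ei + t *\<^sub>R ?ej)"
        "norm (partial_deriv i \<phi> (x + s *\<^sub>R ?ei) - partial_deriv i \<phi> x - L (s *\<^sub>R ?ei)) \<le> (e/3) * norm (s *\<^sub>R ?ei)"
        using d(2)[of "x + (s *\<^sub>R ?ei + t *\<^sub>R ?ej)"] d(2)[of "x + s *\<^sub>R ?ei"] that t by auto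
      moreover have "(e/3) * norm (s *\<^sub>R ?ei + t *\<^sub>R ?ej) \<le> (e/3) * (2 * t)" "(e/3) * norm (s *\<^sub>R ?ei) \<le> (e/3) * t"
        using ne that \<open>e > 0\<close> by (auto intro!: mult_left_mono)
      moreover have "G' s = (partial_deriv i \<phi> (x + (s *\<^sub>R ?ei + t *\<^sub>R ?ej)) - partial_deriv i \<phi> x - L (s *\<^sub>R ?ei + t *\<^sub>R ?ej))
          - (partial_deriv i \<phi> (x + s *\<^sub>R ?ei) - partial_deriv i \<phi> x - L (s *\<^sub>R ?ei))"
        unfolding G'_def by (simp add: L.add L.scale algebra_simps)
      ultimately have "norm (G' s) \<le> (e/3) * (2 * t) + (e/3) * t"
        by (smt (verit) norm_triangle_ineq4)
      then have "norm (G' s) \<le> e * t" by simp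
      then show ?thesis by (intro onorm_bound) (auto simp: mult.commute mult_left_mono t \<open>e > 0\<close> less_imp_le)
    qed
    ultimately have "norm (G t - G 0) \<le> e * t * norm (t - 0)"
      using t by (intro differentiable_bound[of "{0..t}" G "\<lambda>s h. h *\<^sub>R G' s"]) auto
    then show ?thesis
      using t unfolding G_def Lj by (simp add: power2_eq_square algebra_simps)
  qed
  then show ?thesis using d(1) by (intro exI[of _ "d/2"]) auto
qed

lemma partial_deriv_commute:
  fixes \<phi> :: "real^'n \<Rightarrow> complex"
  assumes "smooth_fun \<phi>"
  shows "partial_deriv i (partial_deriv j \<phi>) = partial_deriv j (partial_deriv i \<phi>)"
proof
  fix x
  let ?A = "partial_deriv i (partial_deriv j \<phi>) x" and ?B = "partial_deriv j (partial_deriv i \<phi>) x"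
  have "norm (?A - ?B) \<le> e" if "e > 0" for e
  proof -
    have diff: "\<phi> differentiable (at y)" "partial_deriv k \<phi> differentiable (at y)" for k y
      using assms smooth_fun_imp_differentiable smooth_fun_partial_deriv by blast+
    define S where "S t = \<phi> (x + t *\<^sub>R axis i 1 + t *\<^sub>R axis j 1) - \<phi> (x + t *\<^sub>R axis i 1) - \<phi> (x + t *\<^sub>R axis j 1) + \<phi> x" for t
    have S_sym: "S t = \<phi> (x + t *\<^sub>R axis j 1 + t *\<^sub>R axis i 1) - \<phi> (x + t *\<^sub>R axis j 1) - \<phi> (x + t *\<^sub>R axis i 1) + \<phi> x" for t
      by (simp add: S_def algebra_simps)
    have e2: "e/2 > 0" using that by simp
    obtain d1 where d1: "d1 > 0" "\<And>t. 0 < t \<Longrightarrow> t < d1 \<Longrightarrow> norm (S t - t\<^sup>2 *\<^sub>R ?B) \<le> e/2 * t\<^sup>2"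
      using second_difference_approx[OF diff(1) diff(2)[of i x] e2, of j] unfolding S_def by blast
    obtain d2 where d2: "d2 > 0" "\<And>t. 0 < t \<Longrightarrow> t < d2 \<Longrightarrow> norm (S t - t\<^sup>2 *\<^sub>R ?A) \<le> e/2 * t\<^sup>2"
      using second_difference_approx[OF diff(1) diff(2)[of j x] e2, of i] unfolding S_sym by blast
    define t where "t = min d1 d2 / 2"
    have t: "0 < t" "t < d1" "t < d2" using d1(1) d2(1) by (auto simp: t_def)
    have "norm ((S t - t\<^sup>2 *\<^sub>R ?B) - (S t - t\<^sup>2 *\<^sub>R ?A)) \<le> e/2 * t\<^sup>2 + e/2 * t\<^sup>2"
      by (rule order_trans[OF norm_triangle_ineq4 add_mono[OF d1(2) d2(2)]]) (use t in auto)
    moreover have "(S t - t\<^sup>2 *\<^sub>R ?B) - (S t - t\<^sup>2 *\<^sub>R ?A) = t\<^sup>2 *\<^sub>R (?A - ?B)" by (simp add: algebra_simps)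
    ultimately have "t\<^sup>2 * norm (?A - ?B) \<le> t\<^sup>2 * e" by (simp add: mult.commute)
    then show ?thesis using t by simp
  qed
  then have "norm (?A - ?B) \<le> 0" by (meson field_le_epsilon add_0 le_add_same_cancel2 dual_order.trans order_refl) 
  then show "?A = ?B" by simp
qed

lemma fold_partial_deriv_perm:
  assumes "smooth_fun \<phi>" "mset is = mset js"
  shows "fold partial_deriv is \<phi> = fold partial_deriv js \<phi>"
proof -
  have comm: "fold partial_deriv ks (partial_deriv i \<psi>) = partial_deriv i (fold partial_deriv ks \<psi>)"
    if "smooth_fun \<psi>" for ks i \<psi>
    using that
  proof (induction ks arbitrary: \<psi>)
    case (Cons a ks)
    then show ?case
      using Cons.IH[OF smooth_fun_partial_deriv[OF Cons.prems], of a] partial_deriv_commute[OF Cons.prems, of a i]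
      by simp
  qed simp
  show ?thesis using assms
  proof (induction "is" arbitrary: js \<phi>)
    case (Cons i "is")
    then have "i \<in> set js" by (metis list.set_intros(1) set_mset_mset)
    then obtain A B where js: "js = A @ i # B" by (meson split_list)
    then have "mset is = mset (A @ B)" using Cons.prems by simp
    then have "fold partial_deriv is (partial_deriv i \<phi>) = fold partial_deriv (A @ B) (partial_deriv i \<phi>)"
      using Cons.IH smooth_fun_partial_deriv Cons.prems(1) by blast
    then show ?case using js comm[OF Cons.prems(1)] by simp
  qed simp
qed

text \<open>This and the next lemma translate between multi-indices and lists of coordinates. From here on
derivatives are indexed by lists, which admit induction on the order.\<close>

lemma multi_deriv_as_fold:
  fixes \<alpha> :: "nat^'n"
  obtains "is" where "length is = multi_order \<alpha>" "\<And>\<phi>. multi_deriv \<alpha> \<phi> = fold partial_deriv is \<phi>"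
proof -
  define js where "js = (SOME is. \<forall>i. count_list is i = \<alpha> $ i)"
  obtain ks where "mset ks = (\<Sum>i\<in>UNIV. replicate_mset (\<alpha> $ i) i)" using ex_mset by blast
  then have "count_list ks i = \<alpha> $ i" for i
    by (simp add: count_sum flip: count_mset)
  then have js: "\<forall>i. count_list js i = \<alpha> $ i"
    unfolding js_def by (intro someI[of "\<lambda>is. \<forall>i. count_list is i = \<alpha> $ i" ks]) blast
  have "multi_order \<alpha> = (\<Sum>i\<in>UNIV. count_list js i)" using js by (simp add: multi_order_def)
  then have "length js = multi_order \<alpha>" by (simp add: sum_count_set)
  then show thesis using that[of js] by (simp add: multi_deriv_def js_def)
qed

lemma fold_partial_deriv_as_multi_deriv:
  fixes "is" :: "'n::finite list"
  obtains \<alpha> :: "nat^'n" where "multi_order \<alpha> = length is"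
    "\<And>\<phi>. smooth_fun \<phi> \<Longrightarrow> fold partial_deriv is \<phi> = multi_deriv \<alpha> \<phi>"
proof -
  define \<alpha> :: "nat^'n" where "\<alpha> = (\<chi> i. count_list is i)"
  define js where "js = (SOME js. \<forall>i. count_list js i = \<alpha> $ i)"
  have "\<forall>i. count_list js i = \<alpha> $ i"
    unfolding js_def by (rule someI[of _ "is"]) (simp add: \<alpha>_def)
  then have "mset is = mset js" by (intro multiset_eqI) (simp add: \<alpha>_def flip: count_mset)
  moreover have "multi_order \<alpha> = length is" by (simp add: multi_order_def \<alpha>_def sum_count_set)
  ultimately show thesis
    using that[of \<alpha>] fold_partial_deriv_perm unfolding multi_deriv_def js_def by metis
qed

section \<open>Interpolation and uniform limits of derivatives\<close>

text \<open>Landau's interpolation inequality: the difference quotient with step \<open>t\<close> is at most \<open>2 * e / t\<close>, and it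
differs from the derivative by at most \<open>t * B\<close>.\<close>

lemma norm_partial_deriv_le:
  fixes w :: "real^'n \<Rightarrow> complex"
  assumes w: "\<And>y. w differentiable (at y)" and dw: "\<And>y. partial_deriv i w differentiable (at y)"
    and e: "\<And>y. norm (w y) \<le> e" and B: "\<And>y. norm (partial_deriv i (partial_deriv i w) y) \<le> B"
    and "t > 0"
  shows "norm (partial_deriv i w x) \<le> 2 * e / t + t * B"
proof -
  let ?v = "axis i 1 :: real^'n"
  have B0: "0 \<le> B" using B[of x] norm_ge_zero order_trans by blast
  have lip: "norm (partial_deriv i w (x + s *\<^sub>R ?v) - partial_deriv i w x) \<le> t * B" if "s \<in> {0..t}" for s
  proof -
    have "norm (partial_deriv i w (x + s *\<^sub>R ?v) - partial_deriv i w (x + 0 *\<^sub>R ?v)) \<le> B * norm (s - 0)"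
      using that \<open>t > 0\<close>
      by (intro differentiable_bound[of "{0..t}" _ "\<lambda>s h. h *\<^sub>R partial_deriv i (partial_deriv i w) (x + s *\<^sub>R ?v)"]
          has_derivative_along_axis dw onorm_bound) (auto intro!: mult_right_mono B B0 simp: mult.commute[of _ "norm (partial_deriv _ _ _)"])
    also have "\<dots> \<le> B * t" using that B0 by (intro mult_left_mono) auto
    finally show ?thesis by (simp add: mult.commute)
  qed
  define g where "g s = w (x + s *\<^sub>R ?v) - s *\<^sub>R partial_deriv i w x" for s
  have "norm (g t - g 0) \<le> t * B * norm (t - 0)"
  proof (rule differentiable_bound[of "{0..t}" g "\<lambda>s h. h *\<^sub>R (partial_deriv i w (x + s *\<^sub>R ?v) - partial_deriv i w x)"])
    fix s assume s: "s \<in> {0..t}"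
    show "(g has_derivative (\<lambda>h. h *\<^sub>R (partial_deriv i w (x + s *\<^sub>R ?v) - partial_deriv i w x))) (at s within {0..t})"
      unfolding g_def using has_derivative_along_axis[OF w, of x i s "{0..t}"] by (auto intro!: derivative_eq_intros simp: algebra_simps)
    show "onorm (\<lambda>h. h *\<^sub>R (partial_deriv i w (x + s *\<^sub>R ?v) - partial_deriv i w x)) \<le> t * B"
      using lip[OF s] B0 \<open>t > 0\<close> by (intro onorm_bound) (auto simp: mult.commute mult_left_mono)
  qed (use \<open>t > 0\<close> in auto)
  then have 1: "norm (w (x + t *\<^sub>R ?v) - w x - t *\<^sub>R partial_deriv i w x) \<le> t * B * t"
    using \<open>t > 0\<close> by (simp add: g_def algebra_simps)
  have "t *\<^sub>R partial_deriv i w x = w (x + t *\<^sub>R ?v) - w x - (w (x + t *\<^sub>R ?v) - w x - t *\<^sub>R partial_deriv i w x)"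
    by simp
  then have "norm (t *\<^sub>R partial_deriv i w x) \<le> norm (w (x + t *\<^sub>R ?v)) + norm (w x)
      + norm (w (x + t *\<^sub>R ?v) - w x - t *\<^sub>R partial_deriv i w x)"
    by (metis norm_triangle_ineq4 add_mono_thms_linordered_semiring(3) order_trans)
  then have "t * norm (partial_deriv i w x) \<le> 2 * e + t * B * t"
    using 1 e[of x] e[of "x + t *\<^sub>R ?v"] \<open>t > 0\<close> by simp
  then show ?thesis using \<open>t > 0\<close> by (simp add: field_simps)
qed

text \<open>Interpolation propagates uniform convergence to \<open>0\<close> from one order of differentiation to the next, as
long as the derivatives two orders higher stay bounded.\<close>

lemma uniform_limit_fold_partial_deriv_0:
  fixes w :: "'a \<Rightarrow> real^'n \<Rightarrow> complex"
  assumes smooth: "\<And>m. smooth_fun (w m)"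
    and bound: "\<And>m is x. norm (fold partial_deriv is (w m) x) \<le> b (length is)"
    and lim: "uniform_limit UNIV w (\<lambda>_. 0) F"
  shows "uniform_limit UNIV (\<lambda>m. fold partial_deriv is (w m)) (\<lambda>_. 0) F"
proof (induction "is" rule: rev_induct)
  case (snoc i "is")
  show ?case
  proof (rule uniform_limitI)
    fix e :: real assume "e > 0"
    define B where "B = \<bar>b (length is + 2)\<bar> + 1"
    have "B > 0" by (simp add: B_def)
    \<comment> \<open>In the interpolation inequality both terms become \<open>e / 3\<close>.\<close>
    define t where "t = e / (3 * B)"
    have t: "t > 0" "t * B = e / 3" using \<open>e > 0\<close> \<open>B > 0\<close> by (auto simp: t_def)
    have "\<forall>\<^sub>F m in F. \<forall>x\<in>UNIV. dist (fold partial_deriv is (w m) x) 0 < t * e / 6"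
      using snoc.IH t \<open>e > 0\<close> by (intro uniform_limitD) auto
    then show "\<forall>\<^sub>F m in F. \<forall>x\<in>UNIV. dist (fold partial_deriv (is @ [i]) (w m) x) 0 < e"
    proof eventually_elim
      case (elim m)
      have "norm (partial_deriv i (fold partial_deriv is (w m)) x) \<le> 2 * (t * e / 6) / t + t * B" for x
      proof (rule norm_partial_deriv_le[OF _ _ _ _ t(1)])
        show "fold partial_deriv is (w m) differentiable (at y)" for y
          by (rule smooth_fun_differentiable[OF smooth])
        show "partial_deriv i (fold partial_deriv is (w m)) differentiable (at y)" for y
          using smooth_fun_differentiable[OF smooth, of "is @ [i]"] by simp
        show "norm (fold partial_deriv is (w m) y) \<le> t * e / 6" for y
          using elim by (simp add: less_imp_le)
        show "norm (partial_deriv i (partial_deriv i (fold partial_deriv is (w m))) y) \<le> B" for y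
          using bound[of "is @ [i, i]" m y] by (simp add: B_def)
      qed
      moreover have "2 * (t * e / 6) / t + t * B < e" using t \<open>e > 0\<close> by (simp add: field_simps)
      ultimately show ?case by (auto intro: le_less_trans)
    qed
  qed
qed (use lim in simp)

text \<open>The previous lemma, applied to the differences \<open>g j - g k\<close> along pairs of indices, shows that every
sequence of derivatives is uniformly Cauchy.\<close>

lemma smooth_fun_uniform_limit:
  fixes g :: "nat \<Rightarrow> real^'n \<Rightarrow> complex"
  assumes smooth: "\<And>m. smooth_fun (g m)"
    and bound: "\<And>m is x. norm (fold partial_deriv is (g m) x) \<le> b (length is)"
    and lim: "uniform_limit UNIV g \<psi> sequentially"
  shows "smooth_fun \<psi>"
    and "uniform_limit UNIV (\<lambda>m. fold partial_deriv is (g m)) (fold partial_deriv is \<psi>) sequentially"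
proof -
  define w where "w = (\<lambda>(j, k) x. g j x - g k x)"
  have smooth_w: "smooth_fun (w p)" for p
    using smooth_fun_lincomb[OF smooth smooth, of 1 _ "-1"] by (simp add: w_def case_prod_beta)
  have fold_w: "fold partial_deriv is (w (j, k)) = (\<lambda>x. fold partial_deriv is (g j) x - fold partial_deriv is (g k) x)" for "is" j k
    unfolding w_def by (simp add: fold_partial_deriv_diff[OF smooth smooth])
  have bound_w: "norm (fold partial_deriv is (w p) x) \<le> 2 * b (length is)" for "is" p x
    using norm_triangle_ineq4[of "fold partial_deriv is (g (fst p)) x" "fold partial_deriv is (g (snd p)) x"]
      bound[of "is" "fst p" x] bound[of "is" "snd p" x] fold_w[of "is" "fst p" "snd p"]
    by simp
  have lim_w: "uniform_limit UNIV w (\<lambda>_. 0) (sequentially \<times>\<^sub>F sequentially)"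
  proof (rule uniform_limitI)
    fix e :: real assume "e > 0"
    then have "\<forall>\<^sub>F m in sequentially. \<forall>x\<in>UNIV. dist (g m x) (\<psi> x) < e/2"
      by (intro uniform_limitD[OF lim]) auto
    then obtain N where "\<And>m x. m \<ge> N \<Longrightarrow> dist (g m x) (\<psi> x) < e/2"
      unfolding eventually_sequentially by auto
    then have "\<forall>\<^sub>F p in sequentially \<times>\<^sub>F sequentially.
        \<forall>x. dist (g (fst p) x) (\<psi> x) < e/2 \<and> dist (g (snd p) x) (\<psi> x) < e/2"
      unfolding eventually_prod_sequentially by (intro exI[of _ N]) auto
    then show "\<forall>\<^sub>F p in sequentially \<times>\<^sub>F sequentially. \<forall>x\<in>UNIV. dist (w p x) 0 < e"
    proof eventually_elim
      case (elim p)
      show ?case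
      proof
        fix x
        have "dist (g (fst p) x) (g (snd p) x) < e"
          using dist_triangle_half_l[of "g (fst p) x" "\<psi> x" e "g (snd p) x"] elim by blast
        then show "dist (w p x) 0 < e" by (simp add: w_def case_prod_beta dist_norm)
      qed
    qed
  qed
  have conv: "uniformly_convergent_on UNIV (\<lambda>m. fold partial_deriv is (g m))" for "is"
  proof (rule Cauchy_uniformly_convergent, rule uniformly_Cauchy_onI)
    fix e :: real assume "e > 0"
    from uniform_limitD[OF uniform_limit_fold_partial_deriv_0[OF smooth_w bound_w lim_w] this]
    have "\<forall>\<^sub>F p in sequentially \<times>\<^sub>F sequentially. \<forall>x\<in>UNIV. dist (fold partial_deriv is (w p) x) 0 < e" .
    then obtain N where "\<And>j k. j \<ge> N \<Longrightarrow> k \<ge> N \<Longrightarrow> \<forall>x\<in>UNIV. dist (fold partial_deriv is (w (j, k)) x) 0 < e"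
      unfolding eventually_prod_sequentially by blast
    then show "\<exists>N. \<forall>x\<in>UNIV. \<forall>m\<ge>N. \<forall>n\<ge>N. dist (fold partial_deriv is (g m) x) (fold partial_deriv is (g n) x) < e"
      unfolding fold_w by (auto simp: dist_norm)
  qed
  define G where "G is x = lim (\<lambda>m. fold partial_deriv is (g m) x)" for "is" x
  have G: "uniform_limit UNIV (\<lambda>m. fold partial_deriv is (g m)) (G is) sequentially" for "is"
    using conv[of "is"] unfolding uniformly_convergent_uniform_limit_iff G_def .
  have G_lim: "(\<lambda>m. fold partial_deriv is (g m) x) \<longlonglongrightarrow> G is x" for "is" x
    using tendsto_uniform_limitI[OF G] by simp
  have deriv: "(G is has_derivative (\<lambda>h. \<Sum>i\<in>UNIV. (h $ i) *\<^sub>R G (is @ [i]) x)) (at x)" for "is" x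
  proof -
    have "\<exists>f. \<forall>x\<in>UNIV. (\<lambda>m. fold partial_deriv is (g m) x) \<longlonglongrightarrow> f x \<and>
        (f has_derivative (\<lambda>h. \<Sum>i\<in>UNIV. (h $ i) *\<^sub>R G (is @ [i]) x)) (at x)"
    proof (rule has_derivative_sequence[OF convex_UNIV, where f' = "\<lambda>m x h. \<Sum>i\<in>UNIV. (h $ i) *\<^sub>R fold partial_deriv (is @ [i]) (g m) x"])
      show "(fold partial_deriv is (g m) has_derivative
          (\<lambda>h. \<Sum>i\<in>UNIV. (h $ i) *\<^sub>R fold partial_deriv (is @ [i]) (g m) x)) (at x)" for m x
        using has_derivative_partial_derivs[OF smooth_fun_differentiable[OF smooth]] by simp
      show "\<forall>\<^sub>F m in sequentially. \<forall>x\<in>UNIV. \<forall>h.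
          norm ((\<Sum>i\<in>UNIV. (h $ i) *\<^sub>R fold partial_deriv (is @ [i]) (g m) x) - (\<Sum>i\<in>UNIV. (h $ i) *\<^sub>R G (is @ [i]) x)) \<le> e * norm h"
        if "e > 0" for e
      proof -
        define d where "d = e / real CARD('n)"
        have "d > 0" "real CARD('n) * d = e" using that by (auto simp: d_def)
        have "\<forall>\<^sub>F m in sequentially. \<forall>i\<in>UNIV. \<forall>x\<in>UNIV. dist (fold partial_deriv (is @ [i]) (g m) x) (G (is @ [i]) x) < d"
          by (intro eventually_ball_finite[OF finite[of "UNIV :: 'n set"]] ballI[where A = "UNIV :: 'n set"] uniform_limitD[OF G \<open>d > 0\<close>])
        then show ?thesis
        proof eventually_elim
          case (elim m)
          have bd: "norm ((\<Sum>i\<in>UNIV. (h $ i) *\<^sub>R fold partial_deriv (is @ [i]) (g m) x) - (\<Sum>i\<in>UNIV. (h $ i) *\<^sub>R G (is @ [i]) x))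
              \<le> real CARD('n) * (norm h * d)" for x and h :: "real^'n"
          proof -
            have "(\<Sum>i\<in>UNIV. (h $ i) *\<^sub>R fold partial_deriv (is @ [i]) (g m) x) - (\<Sum>i\<in>UNIV. (h $ i) *\<^sub>R G (is @ [i]) x)
              = (\<Sum>i\<in>UNIV. (h $ i) *\<^sub>R (fold partial_deriv (is @ [i]) (g m) x - G (is @ [i]) x))"
              by (simp add: sum_subtractf scaleR_diff_right)
            also have "norm \<dots> \<le> real CARD('n) * (norm h * d)"
            proof (rule sum_norm_bound[THEN order_trans])
              show "norm ((h $ i) *\<^sub>R (fold partial_deriv (is @ [i]) (g m) x - G (is @ [i]) x)) \<le> norm h * d" for i
                using elim component_le_norm_cart[of h i] unfolding norm_scaleR dist_norm
                by (intro mult_mono) (auto simp: less_imp_le)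
            qed simp
            finally show ?thesis .
          qed
          have eq: "e * norm h = real CARD('n) * (norm h * d)" for h :: "real^'n"
            unfolding \<open>real CARD('n) * d = e\<close>[symmetric] by simp
          show ?case unfolding eq using bd by blast
        qed
      qed
      show "(\<lambda>m. fold partial_deriv is (g m) 0) \<longlonglongrightarrow> G is 0" by (rule G_lim)
    qed simp
    then obtain f where f: "\<And>x. (\<lambda>m. fold partial_deriv is (g m) x) \<longlonglongrightarrow> f x"
      "\<And>x. (f has_derivative (\<lambda>h. \<Sum>i\<in>UNIV. (h $ i) *\<^sub>R G (is @ [i]) x)) (at x)" by blast
    have "f = G is" using f(1) G_lim LIMSEQ_unique by blast
    then show ?thesis using f(2) by blast
  qed
  have fold_eq: "fold partial_deriv is \<psi> = G is" for "is"
  proof (induction "is" rule: rev_induct)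
    case Nil
    show ?case using tendsto_uniform_limitI[OF lim] G_lim[of "[]"] LIMSEQ_unique by fastforce
  next
    case (snoc i "is")
    have "partial_deriv i (G is) x = G (is @ [i]) x" for x
      by (simp add: partial_deriv_eqI[OF deriv] axis_def if_distrib[of "\<lambda>z. z *\<^sub>R _"] cong: if_cong)
    then show ?case using snoc.IH by auto
  qed
  show "smooth_fun \<psi>" unfolding smooth_fun_def fold_eq using deriv differentiableI by blast
  show "uniform_limit UNIV (\<lambda>m. fold partial_deriv is (g m)) (fold partial_deriv is \<psi>) sequentially"
    unfolding fold_eq by (rule G)
qed

section \<open>The test spaces in terms of derivative bounds\<close>

definition derivs_bounded_by :: "(nat \<Rightarrow> real) \<Rightarrow> (real^'n \<Rightarrow> complex) \<Rightarrow> bool" where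
  "derivs_bounded_by b \<phi> \<longleftrightarrow> (\<forall>is x. norm (fold partial_deriv is \<phi> x) \<le> b (length is))"

lemma derivs_bounded_byD: "derivs_bounded_by b \<phi> \<Longrightarrow> norm (fold partial_deriv is \<phi> x) \<le> b (length is)"
  by (simp add: derivs_bounded_by_def)

lemma derivs_bounded_by_mono:
  assumes "derivs_bounded_by b \<phi>" "\<And>k. b k \<le> b' k"
  shows "derivs_bounded_by b' \<phi>"
  using assms unfolding derivs_bounded_by_def by (meson order_trans)

lemma derivs_bounded_by_lincomb:
  assumes "smooth_fun \<phi>" "smooth_fun \<psi>" "derivs_bounded_by b \<phi>" "derivs_bounded_by b' \<psi>"
  shows "derivs_bounded_by (\<lambda>k. norm a * b k + norm a' * b' k) (\<lambda>x. a * \<phi> x + a' * \<psi> x)"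
  unfolding derivs_bounded_by_def fold_partial_deriv_lincomb[OF assms(1,2)]
  using assms(3,4)[THEN derivs_bounded_byD]
  by (auto intro!: norm_triangle_le add_mono mult_left_mono simp: norm_mult)

lemma derivs_bounded_by_uminus:
  assumes "smooth_fun \<phi>"
  shows "derivs_bounded_by b (\<lambda>x. - \<phi> x) \<longleftrightarrow> derivs_bounded_by b \<phi>"
  using fold_partial_deriv_lincomb[OF assms assms, of _ "-1" 0] by (simp add: derivs_bounded_by_def)

text \<open>The norm only sees multi-indices and points of \<open>K\<close>. Bounds for arbitrary lists follow from the symmetry
of mixed partial derivatives, and bounds outside \<open>K\<close> from the vanishing of all derivatives there.\<close>

lemma test_step_iff:
  fixes K :: "(real^'n) set"
  assumes "closed K" "\<And>p. M p > 0" "h > 0"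
  shows "\<phi> \<in> test_step M h K \<longleftrightarrow> smooth_fun \<phi> \<and> (\<forall>x. x \<notin> K \<longrightarrow> \<phi> x = 0) \<and>
    (\<exists>C. derivs_bounded_by (\<lambda>k. C * (h ^ k * M k)) \<phi>)"
proof -
  have w: "h ^ k * M k > 0" for k using assms by simp
  have supp: "closure {x. \<phi> x \<noteq> 0} \<subseteq> K \<longleftrightarrow> (\<forall>x. x \<notin> K \<longrightarrow> \<phi> x = 0)"
    using closure_minimal[of "{x. \<phi> x \<noteq> 0}" K] closure_subset[of "{x. \<phi> x \<noteq> 0}"] assms(1) by blast
  have bdd: "bdd_above (ultra_quotient M h \<phi> ` (K \<times> UNIV)) \<longleftrightarrow> (\<exists>C. derivs_bounded_by (\<lambda>k. C * (h ^ k * M k)) \<phi>)"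
    if smooth: "smooth_fun \<phi>" and z: "\<And>x. x \<notin> K \<Longrightarrow> \<phi> x = 0"
  proof
    assume "bdd_above (ultra_quotient M h \<phi> ` (K \<times> UNIV))"
    then obtain C where C: "\<And>p. p \<in> K \<times> UNIV \<Longrightarrow> ultra_quotient M h \<phi> p \<le> C"
      by (meson bdd_above.E imageI)
    have "norm (fold partial_deriv is \<phi> x) \<le> max C 0 * (h ^ length is * M (length is))" for "is" x
    proof (cases "x \<in> K")
      case True
      obtain \<alpha> :: "nat^'n" where \<alpha>: "multi_order \<alpha> = length is" "fold partial_deriv is \<phi> = multi_deriv \<alpha> \<phi>"
        using fold_partial_deriv_as_multi_deriv[of "is"] smooth by metis
      have "norm (multi_deriv \<alpha> \<phi> x) / (h ^ length is * M (length is)) \<le> max C 0"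
        using C[of "(x, \<alpha>)"] True \<alpha>(1) by (simp add: ultra_quotient_def max.coboundedI1)
      then show ?thesis using w[of "length is"] by (simp only: \<alpha>(2) pos_divide_le_eq)
    next
      case False
      have "fold partial_deriv is \<phi> x = 0"
        by (rule fold_partial_deriv_eq_0_on_open[of "- K"]) (use assms(1) z False in auto)
      then show ?thesis using w[of "length is"] by simp
    qed
    then show "\<exists>C. derivs_bounded_by (\<lambda>k. C * (h ^ k * M k)) \<phi>" unfolding derivs_bounded_by_def by blast
  next
    assume "\<exists>C. derivs_bounded_by (\<lambda>k. C * (h ^ k * M k)) \<phi>"
    then obtain C where C: "derivs_bounded_by (\<lambda>k. C * (h ^ k * M k)) \<phi>" by blast
    have "ultra_quotient M h \<phi> (x, \<alpha>) \<le> C" for x \<alpha>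
    proof -
      obtain "is" where "length is = multi_order \<alpha>" "multi_deriv \<alpha> \<phi> = fold partial_deriv is \<phi>"
        using multi_deriv_as_fold by metis
      then show ?thesis
        using derivs_bounded_byD[OF C, of "is" x] w[of "length is"]
        by (simp add: ultra_quotient_def pos_divide_le_eq)
    qed
    then show "bdd_above (ultra_quotient M h \<phi> ` (K \<times> UNIV))" by (intro bdd_aboveI[of _ C]) auto
  qed
  then show ?thesis unfolding test_step_def mem_Collect_eq supp by auto
qed

lemma ultra_norm_le:
  fixes K :: "(real^'n) set"
  assumes "K \<noteq> {}" "\<And>p. M p > 0" "h > 0" "derivs_bounded_by (\<lambda>k. C * (h ^ k * M k)) \<phi>"
  shows "ultra_norm M h K \<phi> \<le> C"
  unfolding ultra_norm_def
proof (rule cSUP_least)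
  fix p :: "(real^'n) \<times> (nat^'n)"
  obtain x \<alpha> where p: "p = (x, \<alpha>)" by fastforce
  obtain "is" where "length is = multi_order \<alpha>" "multi_deriv \<alpha> \<phi> = fold partial_deriv is \<phi>"
    using multi_deriv_as_fold by metis
  then show "ultra_quotient M h \<phi> p \<le> C"
    using derivs_bounded_byD[OF assms(4), of "is" x] assms(2)[of "length is"] \<open>h > 0\<close>
    by (simp add: ultra_quotient_def pos_divide_le_eq p)
qed (use assms in auto)

lemma zero_in_test_step:
  assumes "closed K" "\<And>p. M p > 0" "h > 0"
  shows "(\<lambda>x. 0) \<in> test_step M h K"
  unfolding test_step_iff[OF assms]
  by (auto simp: smooth_fun_zero derivs_bounded_by_def fold_partial_deriv_zero intro!: exI[of _ 0])

lemma test_step_lincomb: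
  assumes "closed K" "\<And>p. M p > 0" "h > 0" "\<phi> \<in> test_step M h K" "\<psi> \<in> test_step M h K"
  shows "(\<lambda>x. a * \<phi> x + a' * \<psi> x) \<in> test_step M h K"
proof -
  from assms obtain C C' where "smooth_fun \<phi>" "smooth_fun \<psi>"
    "\<forall>x. x \<notin> K \<longrightarrow> \<phi> x = 0" "\<forall>x. x \<notin> K \<longrightarrow> \<psi> x = 0"
    "derivs_bounded_by (\<lambda>k. C * (h ^ k * M k)) \<phi>" "derivs_bounded_by (\<lambda>k. C' * (h ^ k * M k)) \<psi>"
    by (auto simp: test_step_iff)
  then show ?thesis
    using derivs_bounded_by_lincomb[of \<phi> \<psi> "\<lambda>k. C * (h ^ k * M k)" "\<lambda>k. C' * (h ^ k * M k)" a a'] assms(1-3)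
    by (auto simp: test_step_iff smooth_fun_lincomb algebra_simps intro!: exI[of _ "norm a * C + norm a' * C'"])
qed

lemma test_step_mono:
  assumes "closed K" "closed K'" "K \<subseteq> K'" "\<And>p. M p > 0" "h > 0" "h \<le> h'"
  shows "test_step M h K \<subseteq> test_step M h' K'"
proof
  fix \<phi> assume "\<phi> \<in> test_step M h K"
  then obtain C where \<phi>: "smooth_fun \<phi>" "\<forall>x. x \<notin> K \<longrightarrow> \<phi> x = 0" and C: "derivs_bounded_by (\<lambda>k. C * (h ^ k * M k)) \<phi>"
    using assms by (auto simp: test_step_iff)
  have "C * (h ^ k * M k) \<le> \<bar>C\<bar> * (h' ^ k * M k)" for k
    using assms(4)[of k] \<open>h > 0\<close> \<open>h \<le> h'\<close> by (intro mult_mono power_mono) auto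
  then have "derivs_bounded_by (\<lambda>k. \<bar>C\<bar> * (h' ^ k * M k)) \<phi>"
    by (rule derivs_bounded_by_mono[OF C])
  then show "\<phi> \<in> test_step M h' K'"
    using \<phi> assms by (auto simp: test_step_iff)
qed

text \<open>The quantifier that distinguishes the two classes; with it, the Roumieu and the Beurling case share
all arguments that only rescale \<open>h\<close>.\<close>

definition for_step_parameters :: "ultra_class \<Rightarrow> (real \<Rightarrow> bool) \<Rightarrow> bool" where
  "for_step_parameters c P \<longleftrightarrow> (case c of Roumieu \<Rightarrow> \<exists>h>0. P h | Beurling \<Rightarrow> \<forall>h>0. P h)"

lemma for_step_parameters_scale:
  assumes "for_step_parameters c P" "r > 0" "\<And>h. h > 0 \<Longrightarrow> P h \<Longrightarrow> Q (r * h)"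
  shows "for_step_parameters c Q"
proof (cases c)
  case Roumieu
  then show ?thesis using assms by (auto simp: for_step_parameters_def intro: mult_pos_pos)
next
  case Beurling
  have "Q h" if "h > 0" for h
    using assms(1,2) assms(3)[of "h / r"] that Beurling by (auto simp: for_step_parameters_def)
  then show ?thesis by (simp add: Beurling for_step_parameters_def)
qed

lemma for_step_parameters_mono:
  assumes "for_step_parameters c P" "\<And>h. h > 0 \<Longrightarrow> P h \<Longrightarrow> Q h"
  shows "for_step_parameters c Q"
  using for_step_parameters_scale[OF assms(1), of 1 Q] assms(2) by simp

lemma for_step_parameters_conj:
  assumes "for_step_parameters c P" "for_step_parameters c Q"
    and mono: "\<And>h h'. 0 < h \<Longrightarrow> h \<le> h' \<Longrightarrow> P h \<Longrightarrow> P h'" "\<And>h h'. 0 < h \<Longrightarrow> h \<le> h' \<Longrightarrow> Q h \<Longrightarrow> Q h'"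
  shows "for_step_parameters c (\<lambda>h. P h \<and> Q h)"
proof (cases c)
  case Roumieu
  then obtain h h' where "h > 0" "P h" "h' > 0" "Q h'"
    using assms(1,2) by (auto simp: for_step_parameters_def)
  then have "max h h' > 0 \<and> P (max h h') \<and> Q (max h h')"
    using mono(1)[of h "max h h'"] mono(2)[of h' "max h h'"] by auto
  then show ?thesis using Roumieu by (auto simp: for_step_parameters_def)
qed (use assms in \<open>auto simp: for_step_parameters_def\<close>)

lemma for_step_parameters_exists: "for_step_parameters c P \<Longrightarrow> \<exists>h>0. P h"
  by (cases c) (auto simp: for_step_parameters_def intro: zero_less_one)

text \<open>The union is open because it is a vector space: it is then itself an absolutely convex neighbourhood
of \<open>0\<close>, and it is stable under translation by its elements.\<close>

lemma topspace_ind_lim: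
  assumes "\<And>i. i \<in> I \<Longrightarrow> (\<lambda>x. 0) \<in> topspace (T i)"
    and "\<And>\<phi> \<psi> a b. \<phi> \<in> (\<Union>i\<in>I. topspace (T i)) \<Longrightarrow> \<psi> \<in> (\<Union>i\<in>I. topspace (T i)) \<Longrightarrow>
      (\<lambda>x. a * \<phi> x + b * \<psi> x) \<in> (\<Union>i\<in>I. topspace (T i))"
  shows "topspace (ind_lim I T) = (\<Union>i\<in>I. topspace (T i))" (is "_ = ?E")
proof
  show "topspace (ind_lim I T) \<subseteq> ?E"
    using openin_topspace[of "ind_lim I T"] unfolding openin_ind_lim by blast
  have "ind_lim_nbhd I T ?E"
    unfolding ind_lim_nbhd_def absolutely_convex_def
  proof (intro conjI ballI allI impI)
    show "\<exists>U. openin (T i) U \<and> (\<lambda>x. 0) \<in> U \<and> U \<subseteq> ?E" if "i \<in> I" for i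
      using that assms(1) by (intro exI[of _ "topspace (T i)"]) auto
  qed (use assms(2) in blast)+
  moreover have "(\<lambda>x. \<phi> x + \<psi> x) \<in> ?E" if "\<phi> \<in> ?E" "\<psi> \<in> ?E" for \<phi> \<psi>
    using assms(2)[OF that, of 1 1] by simp
  ultimately have "openin (ind_lim I T) ?E" unfolding openin_ind_lim by blast
  then show "?E \<subseteq> topspace (ind_lim I T)" by (rule openin_subset)
qed

lemma topspace_proj_lim:
  assumes "I \<noteq> {}"
  shows "topspace (proj_lim I T) = (\<Inter>j\<in>I. topspace (T j))"
proof -
  obtain i where "i \<in> I" using assms by blast
  then have "(\<Inter>j\<in>I. topspace (T j)) \<in> {(\<Inter>j\<in>I. topspace (T j)) \<inter> U |i U. i \<in> I \<and> openin (T i) U}"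
    by (auto intro!: exI[of _ i] exI[of _ "topspace (T i)"])
  then show ?thesis unfolding proj_lim_def topology_generated_by_topspace by blast
qed

lemma topspace_test_compact_topology:
  fixes K :: "(real^'n) set"
  assumes "closed K" "K \<noteq> {}" "\<And>p. M p > 0"
  shows "topspace (test_compact_topology c M K) = {\<phi>. for_step_parameters c (\<lambda>h. \<phi> \<in> test_step M h K)}"
proof -
  have step: "topspace (test_step_topology M h K) = test_step M h K" if "h > 0" for h
    using assms that by (simp add: topspace_test_step_topology)
  show ?thesis
  proof (cases c)
    case Roumieu
    have "topspace (ind_lim {0<..} (\<lambda>h. test_step_topology M h K)) = (\<Union>h\<in>{0<..}. topspace (test_step_topology M h K))"
    proof (rule topspace_ind_lim)
      fix \<phi> \<psi> :: "real^'n \<Rightarrow> complex" and a b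
      assume "\<phi> \<in> (\<Union>h\<in>{0<..}. topspace (test_step_topology M h K))"
        "\<psi> \<in> (\<Union>h\<in>{0<..}. topspace (test_step_topology M h K))"
      then obtain h h' where h: "h > 0" "\<phi> \<in> test_step M h K" "h' > 0" "\<psi> \<in> test_step M h' K"
        using step by auto
      then have "\<phi> \<in> test_step M (max h h') K" "\<psi> \<in> test_step M (max h h') K"
        using test_step_mono[of K K M h "max h h'"] test_step_mono[of K K M h' "max h h'"] assms by auto
      then have "(\<lambda>x. a * \<phi> x + b * \<psi> x) \<in> test_step M (max h h') K"
        using h by (intro test_step_lincomb[OF assms(1,3)]) auto
      then show "(\<lambda>x. a * \<phi> x + b * \<psi> x) \<in> (\<Union>h\<in>{0<..}. topspace (test_step_topology M h K))"
        using h step[of "max h h'"] by (intro UN_I[of "max h h'"]) auto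
    qed (use assms step in \<open>simp add: zero_in_test_step\<close>)
    then show ?thesis using Roumieu step by (auto simp: test_compact_topology_def for_step_parameters_def)
  next
    case Beurling
    have "topspace (proj_lim {0<..} (\<lambda>h. test_step_topology M h K)) = (\<Inter>h\<in>{0<..}. topspace (test_step_topology M h K))"
      by (rule topspace_proj_lim) (auto intro: exI[of _ 1])
    then show ?thesis using Beurling step by (auto simp: test_compact_topology_def for_step_parameters_def)
  qed
qed

lemma compact_subset_cball_pos:
  fixes K :: "'a::real_normed_vector set"
  assumes "compact K"
  obtains R where "R > 0" "K \<subseteq> cball 0 R"
  using bounded_pos[of K] compact_imp_bounded[OF assms] by (auto simp: subset_eq)

text \<open>Balls about the origin are cofinal among the compact sets, and they are stable under rotations.\<close>

lemma test_space_eq: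
  fixes M :: "nat \<Rightarrow> real"
  assumes "\<And>p. M p > 0"
  shows "test_space c M = {\<phi> :: real^'n \<Rightarrow> complex.
    \<exists>R>0. for_step_parameters c (\<lambda>h. \<phi> \<in> test_step M h (cball 0 R))}"
proof -
  let ?I = "{K :: (real^'n) set. compact K \<and> interior K \<noteq> {}}"
  have K: "closed K" "K \<noteq> {}" if "K \<in> ?I" for K
    using that compact_imp_closed interior_subset by auto
  note top = topspace_test_compact_topology[OF K assms]
  have ball: "cball 0 R \<in> ?I" if "R > 0" for R using that by simp
  have ex: "\<exists>R>0. for_step_parameters c (\<lambda>h. \<phi> \<in> test_step M h (cball 0 R))"
    if mem: "\<phi> \<in> (\<Union>K\<in>?I. topspace (test_compact_topology c M K))" for \<phi>
  proof -
    obtain K where K'1: "K \<in> ?I" and "\<phi> \<in> topspace (test_compact_topology c M K)"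
      using mem by (rule UN_E)
    then have K': "for_step_parameters c (\<lambda>h. \<phi> \<in> test_step M h K)"
      unfolding top[OF K'1 K'1] by simp
    obtain R where R: "R > 0" "K \<subseteq> cball 0 R" using K'1 compact_subset_cball_pos by blast
    have "for_step_parameters c (\<lambda>h. \<phi> \<in> test_step M h (cball 0 R))"
      using K' by (rule for_step_parameters_mono)
        (erule rev_subsetD[OF _ test_step_mono[OF K(1)[OF K'1] closed_cball R(2) assms _ order_refl]])
    then show ?thesis using R(1) by blast
  qed
  have "topspace (ind_lim ?I (test_compact_topology c M)) = (\<Union>K\<in>?I. topspace (test_compact_topology c M K))"
  proof (rule topspace_ind_lim)
    show "(\<lambda>x. 0) \<in> topspace (test_compact_topology c M K)" if "K \<in> ?I" for K
      using zero_in_test_step[OF K(1)[OF that] assms] unfolding top[OF that that]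
      by (cases c) (auto simp: for_step_parameters_def intro: exI[of _ 1])
  next
    fix \<phi> \<psi> :: "real^'n \<Rightarrow> complex" and a b
    assume "\<phi> \<in> (\<Union>K\<in>?I. topspace (test_compact_topology c M K))"
      "\<psi> \<in> (\<Union>K\<in>?I. topspace (test_compact_topology c M K))"
    then obtain R R' where R: "R > 0" "R' > 0"
      "for_step_parameters c (\<lambda>h. \<phi> \<in> test_step M h (cball 0 R))"
      "for_step_parameters c (\<lambda>h. \<psi> \<in> test_step M h (cball 0 R'))"
      using ex by meson
    let ?R = "max R R'"
    have "for_step_parameters c (\<lambda>h. \<phi> \<in> test_step M h (cball 0 ?R))"
      using R(3) by (rule for_step_parameters_mono)
        (erule rev_subsetD[OF _ test_step_mono[OF closed_cball closed_cball _ assms _ order_refl]], auto)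
    moreover have "for_step_parameters c (\<lambda>h. \<psi> \<in> test_step M h (cball 0 ?R))"
      using R(4) by (rule for_step_parameters_mono)
        (erule rev_subsetD[OF _ test_step_mono[OF closed_cball closed_cball _ assms _ order_refl]], auto)
    ultimately have "for_step_parameters c (\<lambda>h. \<phi> \<in> test_step M h (cball 0 ?R) \<and> \<psi> \<in> test_step M h (cball 0 ?R))"
      by (rule for_step_parameters_conj)
        (erule (2) rev_subsetD[OF _ test_step_mono[OF closed_cball closed_cball order_refl assms]])+
    then have "for_step_parameters c (\<lambda>h. (\<lambda>x. a * \<phi> x + b * \<psi> x) \<in> test_step M h (cball 0 ?R))"
      by (rule for_step_parameters_mono) (elim conjE, rule test_step_lincomb[OF closed_cball assms])
    then show "(\<lambda>x. a * \<phi> x + b * \<psi> x) \<in> (\<Union>K\<in>?I. topspace (test_compact_topology c M K))"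
      using ball[of ?R] R(1) top by (intro UN_I[of "cball 0 ?R"]) auto
  qed
  then have "test_space c M = (\<Union>K\<in>?I. topspace (test_compact_topology c M K))"
    by (simp add: test_space_def test_topology_def)
  also have "\<dots> = {\<phi>. \<exists>R>0. for_step_parameters c (\<lambda>h. \<phi> \<in> test_step M h (cball 0 R))}"
  proof (intro equalityI subsetI CollectI)
    fix \<phi> :: "real^'n \<Rightarrow> complex"
    assume "\<phi> \<in> {\<phi>. \<exists>R>0. for_step_parameters c (\<lambda>h. \<phi> \<in> test_step M h (cball 0 R))}"
    then obtain R where R: "R > 0" "for_step_parameters c (\<lambda>h. \<phi> \<in> test_step M h (cball 0 R))"
      by blast
    then have "\<phi> \<in> topspace (test_compact_topology c M (cball 0 R))"
      unfolding top[OF ball[OF R(1)] ball[OF R(1)]] by simp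
    then show "\<phi> \<in> (\<Union>K\<in>?I. topspace (test_compact_topology c M K))"
      by (rule UN_I[OF ball[OF R(1)]])
  qed (rule ex)
  finally show ?thesis .
qed

section \<open>Null sequences of test functions\<close>

text \<open>For Roumieu classes this is convergence to \<open>0\<close> in a single step, for Beurling classes in every step.\<close>

definition test_null_sequence ::
  "ultra_class \<Rightarrow> (nat \<Rightarrow> real) \<Rightarrow> (real^'n) set \<Rightarrow> (nat \<Rightarrow> real^'n \<Rightarrow> complex) \<Rightarrow> bool" where
  "test_null_sequence c M K u \<longleftrightarrow> for_step_parameters c (\<lambda>h. (\<forall>j. u j \<in> test_step M h K) \<and>
     (\<forall>e>0. \<forall>\<^sub>F j in sequentially. derivs_bounded_by (\<lambda>k. e * (h ^ k * M k)) (u j)))"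

lemma eventually_in_step_nbhd:
  fixes K :: "(real^'n) set"
  assumes "closed K" "K \<noteq> {}" "\<And>p. M p > 0" "h > 0"
    and u: "\<And>j. u j \<in> test_step M h K"
    and lim: "\<And>e. e > 0 \<Longrightarrow> \<forall>\<^sub>F j in sequentially. derivs_bounded_by (\<lambda>k. e * (h ^ k * M k)) (u j)"
    and U: "openin (test_step_topology M h K) U" "(\<lambda>x. 0) \<in> U"
  shows "\<forall>\<^sub>F j in sequentially. u j \<in> U"
proof -
  interpret Metric_space "test_step M h K" "test_step_dist M h K"
    by (rule Metric_space_test_step[OF assms(3,4,2)])
  obtain r where r: "r > 0" "mball (\<lambda>x. 0) r \<subseteq> U"
    using U unfolding test_step_topology_def openin_mtopology by blast
  have z: "(\<lambda>x. 0) \<in> test_step M h K" by (rule zero_in_test_step[OF assms(1,3,4)])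
  have "r / 2 > 0" using r by simp
  from lim[OF this] show ?thesis
  proof eventually_elim
    case (elim j)
    have "smooth_fun (u j)" using u[of j] by (simp add: test_step_def)
    then have "derivs_bounded_by (\<lambda>k. r / 2 * (h ^ k * M k)) (\<lambda>x. 0 - u j x)"
      using elim by (simp add: derivs_bounded_by_uminus)
    then have "ultra_norm M h K (\<lambda>x. 0 - u j x) \<le> r / 2"
      by (rule ultra_norm_le[OF assms(2,3,4)])
    then have "u j \<in> mball (\<lambda>x. 0) r"
      using z u r by (simp add: in_mball test_step_dist_def)
    then show ?case using r by blast
  qed
qed

text \<open>In the Beurling case the neighbourhoods are generated by those of the steps under finite
intersections and unions, and the sequence is eventually in each generator that contains \<open>0\<close>.\<close>

lemma eventually_in_compact_nbhd:
  fixes K :: "(real^'n) set"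
  assumes "closed K" "K \<noteq> {}" "\<And>p. M p > 0" and u: "test_null_sequence c M K u"
    and U: "openin (test_compact_topology c M K) U" "(\<lambda>x. 0) \<in> U"
  shows "\<forall>\<^sub>F j in sequentially. u j \<in> U"
proof (cases c)
  case Roumieu
  then obtain h where h: "h > 0" "\<And>j. u j \<in> test_step M h K"
    "\<And>e. e > 0 \<Longrightarrow> \<forall>\<^sub>F j in sequentially. derivs_bounded_by (\<lambda>k. e * (h ^ k * M k)) (u j)"
    using u by (auto simp: test_null_sequence_def for_step_parameters_def)
  have "openin (ind_lim {0<..} (\<lambda>h. test_step_topology M h K)) U"
    using U(1) Roumieu by (simp add: test_compact_topology_def)
  then obtain V where V: "ind_lim_nbhd {0<..} (\<lambda>h. test_step_topology M h K) V" "\<And>\<psi>. \<psi> \<in> V \<Longrightarrow> (\<lambda>x. 0 + \<psi> x) \<in> U"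
    using U(2) unfolding openin_ind_lim by blast
  then obtain U' where "openin (test_step_topology M h K) U'" "(\<lambda>x. 0) \<in> U'" "U' \<subseteq> V"
    using h(1) unfolding ind_lim_nbhd_def by (metis greaterThan_iff)
  then have "\<forall>\<^sub>F j in sequentially. u j \<in> U'"
    using eventually_in_step_nbhd[OF assms(1-3) h] by blast
  then show ?thesis
  proof eventually_elim
    case (elim j)
    then show ?case using V(2)[of "u j"] \<open>U' \<subseteq> V\<close> by auto
  qed
next
  case Beurling
  let ?T = "\<lambda>h. test_step_topology M h K"
  have h: "\<And>j. u j \<in> test_step M h K"
    "\<And>e. e > 0 \<Longrightarrow> \<forall>\<^sub>F j in sequentially. derivs_bounded_by (\<lambda>k. e * (h ^ k * M k)) (u j)" if "h > 0" for h
    using u Beurling that by (auto simp: test_null_sequence_def for_step_parameters_def)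
  have "generate_topology_on {(\<Inter>j\<in>{0<..}. topspace (?T j)) \<inter> U | i U. i \<in> {0<..} \<and> openin (?T i) U} U"
    using U(1) Beurling openin_topology_generated_by by (fastforce simp: test_compact_topology_def proj_lim_def)
  then show ?thesis using U(2)
  proof induction
    case (Int a b)
    then show ?case by (auto intro: eventually_conj)
  next
    case (UN \<K>)
    then obtain k where "k \<in> \<K>" "(\<lambda>x. 0) \<in> k" by blast
    then have "\<forall>\<^sub>F j in sequentially. u j \<in> k" using UN by blast
    then show ?case by (rule eventually_mono) (use \<open>k \<in> \<K>\<close> in blast)
  next
    case (Basis s)
    then obtain i V where s: "s = (\<Inter>j\<in>{0<..}. topspace (?T j)) \<inter> V" "i > 0" "openin (?T i) V" "(\<lambda>x. 0) \<in> V"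
      by auto
    have "u j \<in> (\<Inter>j\<in>{0<..}. topspace (?T j))" for j
      using h(1) topspace_test_step_topology[of M _ K] assms(2,3) by simp
    moreover have "\<forall>\<^sub>F j in sequentially. u j \<in> V"
      using eventually_in_step_nbhd[OF assms(1-3) s(2) h(1)[OF s(2)] h(2)[OF s(2)] s(3,4)] by blast
    ultimately show ?case unfolding s(1) by simp
  qed simp
qed

lemma ultradistribution_tendsto_0:
  fixes f :: "(real^'n \<Rightarrow> complex) \<Rightarrow> complex"
  assumes "\<And>p. M p > 0" "f \<in> ultradistributions c M" "R > 0" "test_null_sequence c M (cball 0 R) u"
  shows "(\<lambda>j. f (u j)) \<longlonglongrightarrow> 0"
proof (rule tendstoI)
  fix e :: real assume "e > 0"
  let ?I = "{K :: (real^'n) set. compact K \<and> interior K \<noteq> {}}"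
  have cont: "continuous_map (test_topology c M) euclidean f"
    and scale: "\<And>\<phi> a. \<phi> \<in> test_space c M \<Longrightarrow> f (\<lambda>x. a * \<phi> x) = a * f \<phi>"
    using assms(2) by (auto simp: ultradistributions_def)
  have z: "(\<lambda>x. 0) \<in> test_space c M"
    unfolding test_space_eq[OF assms(1)] using zero_in_test_step[where M = M, OF closed_cball assms(1)]
    by (cases c) (auto simp: for_step_parameters_def intro!: exI[of _ 1])
  have f0: "f (\<lambda>x. 0) = 0" using scale[OF z, of 0] by simp
  define W where "W = {\<phi> \<in> topspace (test_topology c M). f \<phi> \<in> ball 0 e}"
  have "openin (test_topology c M) W"
    unfolding W_def by (rule openin_continuous_map_preimage[OF cont]) simp
  moreover have "(\<lambda>x. 0) \<in> W" using z f0 \<open>e > 0\<close> by (simp add: W_def test_space_def)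
  ultimately obtain V where V: "ind_lim_nbhd ?I (test_compact_topology c M) V"
    "\<And>\<psi>. \<psi> \<in> V \<Longrightarrow> (\<lambda>x. 0 + \<psi> x) \<in> W"
    unfolding test_topology_def openin_ind_lim by blast
  have "cball 0 R \<in> ?I" using \<open>R > 0\<close> by simp
  then obtain U where U: "openin (test_compact_topology c M (cball 0 R)) U" "(\<lambda>x. 0) \<in> U" "U \<subseteq> V"
    using V(1) unfolding ind_lim_nbhd_def by blast
  have "\<forall>\<^sub>F j in sequentially. u j \<in> U"
    by (rule eventually_in_compact_nbhd[OF closed_cball _ assms(1,4) U(1,2)]) (use \<open>R > 0\<close> in simp)
  then show "\<forall>\<^sub>F j in sequentially. dist (f (u j)) 0 < e"
  proof eventually_elim
    case (elim j)
    then have "u j \<in> W" using V(2)[of "u j"] U(3) by auto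
    then show ?case by (simp add: W_def dist_commute)
  qed
qed

section \<open>Surface measure and spherical means\<close>

text \<open>The bound on the entries holds because the columns of a rotation matrix are unit vectors.\<close>

lemma rotation_matrix_facts:
  fixes T :: "real^'n^'n"
  assumes "rotation_matrix T"
  shows "orthogonal_transformation (\<lambda>x. T *v x)" "matrix_inv T = transpose T" "rotation_matrix (transpose T)"
    "\<bar>T $ i $ j\<bar> \<le> 1"
proof -
  have o: "orthogonal_matrix T" and d: "det T = 1" using assms by (auto simp: rotation_matrix_def)
  show ot: "orthogonal_transformation (\<lambda>x. T *v x)"
    using o by (simp add: orthogonal_transformation_matrix)
  have "T ** transpose T = mat 1" "transpose T ** T = mat 1" using o by (auto simp: orthogonal_matrix_def)
  then have "T ** matrix_inv T = mat 1 \<and> matrix_inv T ** T = mat 1"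
    unfolding matrix_inv_def by (intro someI[of "\<lambda>A'. T ** A' = mat 1 \<and> A' ** T = mat 1" "transpose T"] conjI)
  then show "matrix_inv T = transpose T"
    using matrix_mul_assoc[of "transpose T" T "matrix_inv T"] \<open>transpose T ** T = mat 1\<close> by simp
  show "rotation_matrix (transpose T)" using o d by (simp add: rotation_matrix_def)
  have "\<bar>T $ i $ j\<bar> = \<bar>(T *v axis j 1) $ i\<bar>" by (simp add: matrix_vector_mult_basis column_def)
  also have "\<dots> \<le> norm (T *v axis j 1)" by (rule component_le_norm_cart)
  also have "\<dots> = 1" using orthogonal_transformation_norm[OF ot, of "axis j 1"] by simp
  finally show "\<bar>T $ i $ j\<bar> \<le> 1" .
qed

lemma measure_surface_measure_sphere_pos: "0 < measure surface_measure (sphere (0 :: real^'n) 1)"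
  using unit_ball_vol_pos[of "real CARD('n)"] by (simp add: measure_surface_measure_sphere)

lemma finite_measure_surface_measure: "finite_measure (surface_measure :: (real^'n) measure)"
proof
  show "emeasure surface_measure (space (surface_measure :: (real^'n) measure)) \<noteq> \<infinity>"
    using measure_surface_measure_sphere_pos[where 'n = 'n] by (auto simp: measure_def)
qed

lemma sets_surface_measure: "sets (surface_measure :: (real^'n) measure) = sets (restrict_space borel (sphere 0 1))"
  by (simp add: surface_measure_def)

lemma orthogonal_transformation_measurable:
  fixes T :: "real^'n \<Rightarrow> real^'n"
  assumes T: "orthogonal_transformation T"
  shows "T \<in> borel_measurable borel" and "T \<in> measurable surface_measure surface_measure"
proof -
  show Tm: "T \<in> borel_measurable borel"
    using orthogonal_transformation_linear[OF T]
    by (intro borel_measurable_continuous_onI linear_continuous_on) (simp add: linear_conv_bounded_linear)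
  have "T \<in> measurable (restrict_space borel (sphere 0 1)) (restrict_space borel (sphere 0 1))"
    using Tm orthogonal_transformation_norm[OF T] by (intro measurable_restrict_space3) auto
  then show "T \<in> measurable surface_measure surface_measure"
    by (simp cong: measurable_cong_sets add: sets_surface_measure)
qed

text \<open>Radial projection commutes with \<open>T\<close>, so the cone over the preimage of \<open>A\<close> is the preimage of the cone over
\<open>A\<close>, and Lebesgue measure is invariant.\<close>

lemma surface_measure_distr_orthogonal:
  fixes T :: "real^'n \<Rightarrow> real^'n"
  assumes T: "orthogonal_transformation T"
  shows "distr surface_measure surface_measure T = surface_measure"
proof (rule measure_eqI)
  have lin: "linear T" and nT: "\<And>x. norm (T x) = norm x"
    using T by (auto simp: orthogonal_transformation)
  note Tm = orthogonal_transformation_measurable(1)[OF T] and Ts = orthogonal_transformation_measurable(2)[OF T]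
  fix A assume "A \<in> sets (distr surface_measure surface_measure T)"
  then have A: "A \<in> sets borel" "A \<subseteq> sphere 0 1"
    by (auto simp: sets_surface_measure sets_restrict_space_iff)
  let ?B = "{x \<in> cball 0 1 - {0}. sgn x \<in> A}"
  have "sgn \<in> borel_measurable (borel :: (real^'n) measure)"
    unfolding sgn_div_norm by measurable
  from measurable_sets[OF this A(1)] have B: "?B \<in> sets borel"
    using sets.Int[of "sgn -` A" borel "cball 0 1 - {0}"] by (simp add: vimage_def Int_def conj_commute)
  have TA: "T -` A \<inter> sphere 0 1 \<in> sets borel" using measurable_sets[OF Tm A(1)] by auto
  have "emeasure (distr surface_measure surface_measure T) A = emeasure surface_measure (T -` A \<inter> sphere 0 1)"
    using A Ts by (subst emeasure_distr) (auto simp: sets_surface_measure sets_restrict_space_iff)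
  also have "\<dots> = of_nat CARD('n) * emeasure lborel {x \<in> cball 0 1 - {0}. sgn x \<in> T -` A \<inter> sphere 0 1}"
    by (rule emeasure_surface_measure[OF TA]) auto
  also have "{x \<in> cball 0 1 - {0}. sgn x \<in> T -` A \<inter> sphere 0 1} = T -` ?B"
  proof -
    have "sgn (T x) = T (sgn x)" for x by (simp add: sgn_div_norm nT linear_scale[OF lin])
    moreover have "T x = 0 \<longleftrightarrow> x = 0" for x by (metis nT norm_eq_zero)
    ultimately show ?thesis using nT by (auto simp: norm_sgn)
  qed
  also have "emeasure lborel (T -` ?B) = emeasure (distr lborel borel T) ?B"
    using Tm B by (subst emeasure_distr) auto
  also have "\<dots> = emeasure lborel ?B" by (simp add: lborel_distr_orthogonal[OF T])
  also have "of_nat CARD('n) * emeasure lborel ?B = emeasure surface_measure A"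
    by (rule emeasure_surface_measure[OF A, symmetric])
  finally show "emeasure (distr surface_measure surface_measure T) A = emeasure surface_measure A" .
qed simp

lemma borel_measurable_surface_measure:
  fixes \<phi> :: "real^'n \<Rightarrow> complex"
  assumes "continuous_on UNIV \<phi>"
  shows "(\<lambda>\<omega>. \<phi> (r *\<^sub>R \<omega>)) \<in> borel_measurable surface_measure"
proof -
  have "continuous_on UNIV (\<lambda>\<omega>. \<phi> (r *\<^sub>R \<omega>))"
    by (intro continuous_on_compose2[OF assms] continuous_intros) auto
  then have "(\<lambda>\<omega>. \<phi> (r *\<^sub>R \<omega>)) \<in> borel_measurable (restrict_space borel (sphere 0 1))"
    by (intro measurable_restrict_space1 borel_measurable_continuous_onI)
  then show ?thesis by (simp cong: measurable_cong_sets add: sets_surface_measure)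
qed

lemma integrable_surface_measure:
  fixes \<phi> :: "real^'n \<Rightarrow> complex"
  assumes "continuous_on UNIV \<phi>"
  shows "integrable surface_measure (\<lambda>\<omega>. \<phi> (r *\<^sub>R \<omega>))"
proof -
  interpret finite_measure "surface_measure :: (real^'n) measure" by (rule finite_measure_surface_measure)
  have "compact ((\<lambda>\<omega>. \<phi> (r *\<^sub>R \<omega>)) ` sphere 0 1)"
    by (intro compact_continuous_image continuous_on_compose2[OF assms] continuous_intros) auto
  then obtain B where B: "\<And>\<omega>. \<omega> \<in> sphere 0 1 \<Longrightarrow> norm (\<phi> (r *\<^sub>R \<omega>)) \<le> B"
    using compact_imp_bounded by (fastforce simp: bounded_iff)
  show ?thesis
    using B by (intro integrable_const_bound[of _ B] borel_measurable_surface_measure assms) auto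
qed

lemma spherical_mean_compose_orthogonal:
  fixes \<phi> :: "real^'n \<Rightarrow> complex"
  assumes T: "orthogonal_transformation T" and "continuous_on UNIV \<phi>"
  shows "spherical_mean (\<lambda>x. \<phi> (T x)) = spherical_mean \<phi>"
proof
  fix x :: "real^'n"
  note Tm = orthogonal_transformation_measurable(2)[OF T]
  have "(\<integral>\<omega>. \<phi> (norm x *\<^sub>R \<omega>) \<partial>surface_measure) = (\<integral>\<omega>. \<phi> (norm x *\<^sub>R \<omega>) \<partial>distr surface_measure surface_measure T)"
    by (simp add: surface_measure_distr_orthogonal[OF T])
  also have "\<dots> = (\<integral>\<omega>. \<phi> (norm x *\<^sub>R T \<omega>) \<partial>surface_measure)"
    by (intro integral_distr Tm borel_measurable_surface_measure assms(2))
  finally show "spherical_mean (\<lambda>x. \<phi> (T x)) x = spherical_mean \<phi> x"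
    by (simp add: spherical_mean_def orthogonal_transformation_scaleR[OF T])
qed

lemma spherical_mean_lincomb:
  fixes \<phi> \<psi> :: "real^'n \<Rightarrow> complex"
  assumes "continuous_on UNIV \<phi>" "continuous_on UNIV \<psi>"
  shows "spherical_mean (\<lambda>x. a * \<phi> x + b * \<psi> x) = (\<lambda>x. a * spherical_mean \<phi> x + b * spherical_mean \<psi> x)"
  unfolding spherical_mean_def
  by (simp add: integrable_surface_measure assms scaleR_add_right)

lemma spherical_mean_of_radial:
  fixes \<phi> :: "real^'n \<Rightarrow> complex"
  assumes "\<And>y. norm y = norm x \<Longrightarrow> \<phi> y = \<phi> x"
  shows "spherical_mean \<phi> x = \<phi> x"
proof -
  have "(\<integral>\<omega>. \<phi> (norm x *\<^sub>R \<omega>) \<partial>surface_measure) = (\<integral>\<omega>. \<phi> x \<partial>(surface_measure :: (real^'n) measure))"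
    by (intro Bochner_Integration.integral_cong assms) auto
  also have "\<dots> = measure surface_measure (sphere (0 :: real^'n) 1) *\<^sub>R \<phi> x"
    by simp
  finally show ?thesis
    using measure_surface_measure_sphere_pos[where 'n = 'n] by (simp add: spherical_mean_def)
qed

lemma norm_spherical_mean_le:
  fixes \<phi> :: "real^'n \<Rightarrow> complex"
  assumes "continuous_on UNIV \<phi>" "\<And>y. norm (\<phi> y) \<le> e"
  shows "norm (spherical_mean \<phi> x) \<le> e"
proof -
  let ?s = "measure surface_measure (sphere (0 :: real^'n) 1)"
  interpret finite_measure "surface_measure :: (real^'n) measure" by (rule finite_measure_surface_measure)
  have s: "?s > 0" by (rule measure_surface_measure_sphere_pos)
  have "norm (\<integral>\<omega>. \<phi> (norm x *\<^sub>R \<omega>) \<partial>surface_measure) \<le> (\<integral>\<omega>. norm (\<phi> (norm x *\<^sub>R \<omega>)) \<partial>surface_measure)"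
    by (rule integral_norm_bound)
  also have "\<dots> \<le> (\<integral>\<omega>. e \<partial>(surface_measure :: (real^'n) measure))"
    using assms by (intro integral_mono integrable_norm integrable_surface_measure) auto
  also have "\<dots> = ?s * e" by simp
  finally show ?thesis using s by (simp add: spherical_mean_def field_simps)
qed

section \<open>Averages over rotations\<close>

text \<open>The convex combinations with dyadic weights of rotated copies of \<open>\<phi>\<close>. Midpoints are all that the
parallelogram law uses.\<close>

inductive_set rotation_averages :: "(real^'n \<Rightarrow> complex) \<Rightarrow> (real^'n \<Rightarrow> complex) set"
  for \<phi> where
    rotated: "rotation_matrix T \<Longrightarrow> (\<lambda>x. \<phi> (T *v x)) \<in> rotation_averages \<phi>"
  | midpoint: "u \<in> rotation_averages \<phi> \<Longrightarrow> v \<in> rotation_averages \<phi> \<Longrightarrow>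
      (\<lambda>x. 1/2 * u x + 1/2 * v x) \<in> rotation_averages \<phi>"

lemma rotation_averages_rotated:
  assumes "u \<in> rotation_averages \<phi>" "rotation_matrix T"
  shows "(\<lambda>x. u (T *v x)) \<in> rotation_averages \<phi>"
  using assms(1)
proof induction
  case (rotated S)
  have "rotation_matrix (S ** T)"
    using rotated assms(2) by (simp add: rotation_matrix_def orthogonal_matrix_mul det_mul)
  from rotation_averages.rotated[OF this, of \<phi>] show ?case by (simp add: matrix_vector_mul_assoc)
qed (rule rotation_averages.midpoint)

definition test_function_in_ball :: "real \<Rightarrow> (nat \<Rightarrow> real) \<Rightarrow> (real^'n \<Rightarrow> complex) \<Rightarrow> bool" where
  "test_function_in_ball R b \<phi> \<longleftrightarrow>
    smooth_fun \<phi> \<and> derivs_bounded_by b \<phi> \<and> (\<forall>x. x \<notin> cball 0 R \<longrightarrow> \<phi> x = 0)"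

lemma test_function_in_ballD:
  assumes "test_function_in_ball R b \<phi>"
  shows "smooth_fun \<phi>" "derivs_bounded_by b \<phi>" "x \<notin> cball 0 R \<Longrightarrow> \<phi> x = 0" "continuous_on S \<phi>"
proof -
  show "smooth_fun \<phi>" "derivs_bounded_by b \<phi>" "x \<notin> cball 0 R \<Longrightarrow> \<phi> x = 0"
    using assms by (simp_all add: test_function_in_ball_def)
  then show "continuous_on S \<phi>" by (intro smooth_fun_imp_continuous_on)
qed

lemma test_function_in_ball_diff:
  assumes "test_function_in_ball R b \<phi>" "test_function_in_ball R b \<psi>"
  shows "test_function_in_ball R (\<lambda>k. 2 * b k) (\<lambda>x. \<phi> x - \<psi> x)"
proof -
  note \<phi> = test_function_in_ballD(1,2)[OF assms(1)] and \<psi> = test_function_in_ballD(1,2)[OF assms(2)]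
  have eq: "(\<lambda>x. \<phi> x - \<psi> x) = (\<lambda>x. 1 * \<phi> x + (-1) * \<psi> x)" by simp
  have "derivs_bounded_by (\<lambda>k. norm (1 :: complex) * b k + norm (-1 :: complex) * b k) (\<lambda>x. \<phi> x - \<psi> x)"
    unfolding eq by (rule derivs_bounded_by_lincomb[OF \<phi>(1) \<psi>(1) \<phi>(2) \<psi>(2)])
  then have "derivs_bounded_by (\<lambda>k. 2 * b k) (\<lambda>x. \<phi> x - \<psi> x)"
    by (rule derivs_bounded_by_mono) simp
  moreover have "smooth_fun (\<lambda>x. \<phi> x - \<psi> x)"
    unfolding eq by (rule smooth_fun_lincomb[OF \<phi>(1) \<psi>(1)])
  moreover have "\<phi> x - \<psi> x = 0" if "x \<notin> cball 0 R" for x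
    using test_function_in_ballD(3)[OF assms(1) that] test_function_in_ballD(3)[OF assms(2) that] by simp
  ultimately show ?thesis unfolding test_function_in_ball_def by blast
qed

text \<open>The bounds are the same for all averages; this makes the family of averages equicontinuous together
with all derivatives.\<close>

lemma test_function_in_ball_rotation_averages:
  fixes \<phi> :: "real^'n \<Rightarrow> complex"
  assumes \<phi>: "test_function_in_ball R b \<phi>" and u: "u \<in> rotation_averages \<phi>"
  shows "test_function_in_ball R (\<lambda>k. real CARD('n) ^ k * b k) u"
  using u
proof induction
  case (rotated T)
  note T = rotation_matrix_facts[OF rotated]
  have "derivs_bounded_by (\<lambda>k. real CARD('n) ^ k * b k) (\<lambda>x. \<phi> (T *v x))"
    unfolding derivs_bounded_by_def
    using norm_fold_partial_deriv_compose_matrix_le[OF test_function_in_ballD(1)[OF \<phi>] T(4)]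
      derivs_bounded_byD[OF test_function_in_ballD(2)[OF \<phi>]] by metis
  then show ?case
    using \<phi> orthogonal_transformation_norm[OF T(1)]
    by (auto simp: test_function_in_ball_def smooth_fun_compose_matrix)
next
  case (midpoint u v)
  let ?b = "\<lambda>k. real CARD('n) ^ k * b k"
  have "derivs_bounded_by (\<lambda>k. norm (1/2 :: complex) * ?b k + norm (1/2 :: complex) * ?b k) (\<lambda>x. 1/2 * u x + 1/2 * v x)"
    using midpoint.IH by (intro derivs_bounded_by_lincomb) (auto simp: test_function_in_ball_def)
  then have "derivs_bounded_by ?b (\<lambda>x. 1/2 * u x + 1/2 * v x)" by (simp add: field_simps)
  then show ?case
    using midpoint.IH unfolding test_function_in_ball_def
    by (intro conjI smooth_fun_lincomb) auto
qed

lemma spherical_mean_rotation_averages: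
  fixes \<phi> :: "real^'n \<Rightarrow> complex"
  assumes \<phi>: "test_function_in_ball R b \<phi>" and u: "u \<in> rotation_averages \<phi>"
  shows "spherical_mean u = spherical_mean \<phi>"
  using u
proof induction
  case (rotated T)
  show ?case
    by (rule spherical_mean_compose_orthogonal[OF rotation_matrix_facts(1)[OF rotated] test_function_in_ballD(4)[OF \<phi>]])
next
  case (midpoint u v)
  have "continuous_on UNIV u" "continuous_on UNIV v"
    using test_function_in_ball_rotation_averages[OF \<phi>] midpoint.hyps test_function_in_ballD(4) by blast+
  then show ?case
    unfolding spherical_mean_lincomb[OF \<open>continuous_on UNIV u\<close> \<open>continuous_on UNIV v\<close>] midpoint.IH by simp
qed

definition L2_sq :: "(real^'n \<Rightarrow> complex) \<Rightarrow> real" where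
  "L2_sq u = (\<integral>x. (norm (u x))\<^sup>2 \<partial>lborel)"

lemma integrable_norm_sq:
  fixes u :: "real^'n \<Rightarrow> complex"
  assumes "test_function_in_ball R b u"
  shows "integrable lborel (\<lambda>x. (norm (u x))\<^sup>2)"
proof -
  have "integrable lborel (\<lambda>x. indicator (cball 0 R) x *\<^sub>R (norm (u x))\<^sup>2)"
    by (intro borel_integrable_compact continuous_intros test_function_in_ballD(4)[OF assms]) auto
  also have "(\<lambda>x. indicator (cball 0 R) x *\<^sub>R (norm (u x))\<^sup>2) = (\<lambda>x. (norm (u x))\<^sup>2)"
    using test_function_in_ballD(3)[OF assms] by (auto simp: indicator_def fun_eq_iff)
  finally show ?thesis .
qed

lemma L2_sq_compose_orthogonal:
  fixes u :: "real^'n \<Rightarrow> complex" and T :: "real^'n \<Rightarrow> real^'n"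
  assumes "orthogonal_transformation T" "continuous_on UNIV u"
  shows "L2_sq (\<lambda>x. u (T x)) = L2_sq u"
proof -
  have "L2_sq u = (\<integral>x. (norm (u x))\<^sup>2 \<partial>distr lborel borel T)"
    by (simp add: L2_sq_def lborel_distr_orthogonal[OF assms(1)])
  also have "\<dots> = (\<integral>x. (norm (u (T x)))\<^sup>2 \<partial>lborel)"
    using orthogonal_transformation_measurable(1)[OF assms(1)]
    by (intro integral_distr) (auto intro!: borel_measurable_continuous_onI continuous_intros assms(2))
  finally show ?thesis by (simp add: L2_sq_def)
qed

lemma L2_sq_parallelogram:
  fixes u v :: "real^'n \<Rightarrow> complex"
  assumes "test_function_in_ball R b u" "test_function_in_ball R b v"
    and m: "test_function_in_ball R b (\<lambda>x. 1/2 * u x + 1/2 * v x)"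
  shows "L2_sq (\<lambda>x. u x - v x) = 2 * L2_sq u + 2 * L2_sq v - 4 * L2_sq (\<lambda>x. 1/2 * u x + 1/2 * v x)"
proof -
  have "(norm (a - b'))\<^sup>2 = 2 * (norm a)\<^sup>2 + 2 * (norm b')\<^sup>2 - 4 * (norm (1/2 * a + 1/2 * b'))\<^sup>2" for a b' :: complex
    unfolding cmod_power2 by (simp add: power2_eq_square algebra_simps)
  then show ?thesis
    unfolding L2_sq_def
    using integrable_norm_sq[OF assms(1)] integrable_norm_sq[OF assms(2)] integrable_norm_sq[OF m]
    by simp
qed

text \<open>The bound \<open>b 1\<close> is a Lipschitz bound, so a function of modulus at least \<open>e\<close> at \<open>x\<close> has modulus at least
\<open>e / 2\<close> on a ball about \<open>x\<close> whose radius depends only on \<open>b\<close>, \<open>e\<close>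
and the dimension.\<close>

lemma norm_less_if_L2_sq_small:
  fixes b :: "nat \<Rightarrow> real"
  assumes "e > 0"
  obtains \<delta> where "\<delta> > 0"
    "\<And>(w :: real^'n \<Rightarrow> complex) R x. test_function_in_ball R b w \<Longrightarrow> L2_sq w < \<delta> \<Longrightarrow> norm (w x) < e"
proof -
  define L where "L = real CARD('n) * \<bar>b 1\<bar> + 1"
  \<comment> \<open>\<open>L\<close> is a Lipschitz constant; on a ball of radius \<open>r\<close> the modulus varies by at most \<open>e / 2\<close>.\<close>
  define r where "r = e / (2 * L)"
  have "L > 0" unfolding L_def by (intro add_nonneg_pos) auto
  then have r: "r > 0" "L * r = e / 2" using \<open>e > 0\<close> by (auto simp: r_def)
  define \<delta> where "\<delta> = (e/2)\<^sup>2 * measure lborel (ball (0 :: real^'n) r)"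
  have "norm (w x) < e" if w: "test_function_in_ball R b w" and small: "L2_sq w < \<delta>"
    for w :: "real^'n \<Rightarrow> complex" and R x
  proof (rule ccontr)
    assume "\<not> norm (w x) < e"
    have lip: "norm (w y - w x) \<le> L * norm (y - x)" for y
    proof (rule differentiable_bound[OF convex_UNIV, of w "\<lambda>z h. \<Sum>i\<in>UNIV. (h $ i) *\<^sub>R partial_deriv i w z"])
      show "(w has_derivative (\<lambda>h. \<Sum>i\<in>UNIV. (h $ i) *\<^sub>R partial_deriv i w z)) (at z)" for z
        by (intro has_derivative_partial_derivs smooth_fun_imp_differentiable test_function_in_ballD(1)[OF w])
      show "onorm (\<lambda>h. \<Sum>i\<in>UNIV. (h $ i) *\<^sub>R partial_deriv i w z) \<le> L" for z
      proof (rule onorm_bound)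
        fix h :: "real^'n"
        have "norm ((h $ i) *\<^sub>R partial_deriv i w z) \<le> norm h * \<bar>b 1\<bar>" for i
          using derivs_bounded_byD[OF test_function_in_ballD(2)[OF w], of "[i]" z] component_le_norm_cart[of h i]
          unfolding norm_scaleR by (intro mult_mono) auto
        then have "norm (\<Sum>i\<in>UNIV. (h $ i) *\<^sub>R partial_deriv i w z) \<le> real CARD('n) * (norm h * \<bar>b 1\<bar>)"
          by (intro sum_norm_bound[THEN order_trans]) auto
        also have "\<dots> \<le> L * norm h" by (simp add: L_def algebra_simps)
        finally show "norm (\<Sum>i\<in>UNIV. (h $ i) *\<^sub>R partial_deriv i w z) \<le> L * norm h" .
      qed (use \<open>L > 0\<close> in simp)
    qed auto
    have big: "e / 2 \<le> norm (w y)" if "y \<in> ball x r" for y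
    proof -
      have "L * norm (y - x) \<le> L * r"
        using that \<open>L > 0\<close> by (intro mult_left_mono) (auto simp: dist_norm norm_minus_commute)
      then have "norm (w y - w x) \<le> e / 2" using lip[of y] r by linarith
      then show ?thesis using \<open>\<not> norm (w x) < e\<close> norm_triangle_ineq3[of "w y" "w x"] by linarith
    qed
    have "\<delta> = (\<integral>y. indicator (ball x r) y * (e/2)\<^sup>2 \<partial>lborel)"
      using r(1) by (simp add: \<delta>_def content_ball)
    also have "\<dots> \<le> L2_sq w"
      unfolding L2_sq_def
    proof (rule integral_mono)
      show "integrable lborel (\<lambda>y. indicator (ball x r) y * (e/2)\<^sup>2)"
        using emeasure_lborel_ball_finite[of x r] by (intro integrable_mult_left integrable_real_indicator) auto
      show "indicator (ball x r) y * (e/2)\<^sup>2 \<le> (norm (w y))\<^sup>2" for y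
        using big[of y] \<open>e > 0\<close> by (auto simp: indicator_def intro!: power_mono)
    qed (rule integrable_norm_sq[OF w])
    finally show False using small by simp
  qed
  moreover have "\<delta> > 0" using \<open>e > 0\<close> r(1) content_ball_pos[of r "0 :: real^'n"] by (simp add: \<delta>_def)
  ultimately show thesis using that by blast
qed

text \<open>The midpoint of two averages is an average, so its squared norm is at least \<open>d\<close>. If both norms exceed \<open>d\<close>
by less than \<open>\<delta> / 4\<close>, the parallelogram law bounds the squared norm of the difference by \<open>\<delta>\<close>.\<close>

lemma near_minimal_rotation_averages_close:
  fixes \<phi> :: "real^'n \<Rightarrow> complex"
  assumes \<phi>: "test_function_in_ball R b \<phi>" and "e > 0"
    and d: "\<forall>u\<in>rotation_averages \<phi>. d \<le> L2_sq u"
  shows "\<exists>\<epsilon>>0. \<forall>u\<in>rotation_averages \<phi>. \<forall>v\<in>rotation_averages \<phi>.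
    L2_sq u < d + \<epsilon> \<longrightarrow> L2_sq v < d + \<epsilon> \<longrightarrow> (\<forall>x. norm (u x - v x) < e)"
proof -
  obtain \<delta> where \<delta>: "\<delta> > 0" "\<And>(w :: real^'n \<Rightarrow> complex) R x.
      test_function_in_ball R (\<lambda>k. 2 * (real CARD('n) ^ k * b k)) w \<Longrightarrow> L2_sq w < \<delta> \<Longrightarrow> norm (w x) < e"
    by (rule norm_less_if_L2_sq_small[where 'n = 'n and b = "\<lambda>k. 2 * (real CARD('n) ^ k * b k)", OF \<open>e > 0\<close>]) (rule that; blast)
  have close: "norm (u x - v x) < e" if u: "u \<in> rotation_averages \<phi>" and v: "v \<in> rotation_averages \<phi>"
    and small: "L2_sq u < d + \<delta> / 4" "L2_sq v < d + \<delta> / 4" for u v x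
  proof -
    have m: "(\<lambda>x. 1/2 * u x + 1/2 * v x) \<in> rotation_averages \<phi>" by (rule midpoint[OF u v])
    note t = test_function_in_ball_rotation_averages[OF \<phi>]
    have "L2_sq (\<lambda>x. u x - v x) < \<delta>"
      using L2_sq_parallelogram[OF t[OF u] t[OF v] t[OF m]] bspec[OF d m] small by linarith
    then show ?thesis by (rule \<delta>(2)[OF test_function_in_ball_diff[OF t[OF u] t[OF v]]])
  qed
  show ?thesis
    by (intro exI[of _ "\<delta> / 4"] conjI ballI impI allI close) (use \<delta>(1) in simp)
qed

text \<open>A minimising sequence for the \<open>L\<^sup>2\<close> norm converges uniformly. Its limit is rotation invariant, since a
rotated average is an average of the same norm and hence close to the original one; and a rotation
invariant function is its own spherical mean.\<close>

lemma rotation_averages_approximate_spherical_mean: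
  fixes \<phi> :: "real^'n \<Rightarrow> complex"
  assumes "CARD('n) \<ge> 2" and \<phi>: "test_function_in_ball R b \<phi>"
  obtains g where "\<And>j. g j \<in> rotation_averages \<phi>" "uniform_limit UNIV g (spherical_mean \<phi>) sequentially"
proof -
  let ?A = "rotation_averages \<phi>"
  have ne: "?A \<noteq> {}" using rotated[of "mat 1" \<phi>]
    by (auto simp: rotation_matrix_def orthogonal_matrix_id)
  have bdd: "bdd_below (L2_sq ` ?A)" by (rule bdd_belowI[of _ 0]) (auto simp: L2_sq_def)
  define d where "d = Inf (L2_sq ` ?A)"
  have d: "\<forall>u\<in>?A. d \<le> L2_sq u"
    unfolding d_def using bdd by (intro ballI cInf_lower) auto
  have "\<exists>u\<in>?A. L2_sq u < d + inverse (real (Suc j))" for j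
    using cInf_lessD[of "L2_sq ` ?A" "d + inverse (real (Suc j))"] ne by (auto simp: d_def)
  then obtain g where g: "\<And>j. g j \<in> ?A" "\<And>j. L2_sq (g j) < d + inverse (real (Suc j))"
    by metis
  have ev: "\<exists>N. \<forall>j\<ge>N. L2_sq (g j) < d + \<epsilon>" if pos: "\<epsilon> > 0" for \<epsilon>
  proof -
    obtain N where N: "inverse (real (Suc N)) < \<epsilon>" using reals_Archimedean[OF pos] by blast
    have "L2_sq (g j) < d + \<epsilon>" if "j \<ge> N" for j
    proof -
      have "inverse (real (Suc j)) \<le> inverse (real (Suc N))" using that by (intro le_imp_inverse_le) auto
      then show ?thesis using g(2)[of j] N by linarith
    qed
    then show ?thesis by blast
  qed
  have "uniformly_Cauchy_on UNIV g"
  proof (rule uniformly_Cauchy_onI)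
    fix e :: real assume "e > 0"
    obtain \<epsilon> where "\<epsilon> > 0" and \<epsilon>: "\<forall>u\<in>?A. \<forall>v\<in>?A. L2_sq u < d + \<epsilon> \<longrightarrow> L2_sq v < d + \<epsilon> \<longrightarrow> (\<forall>x. norm (u x - v x) < e)"
      using near_minimal_rotation_averages_close[OF \<phi> \<open>e > 0\<close> d] by blast
    obtain N where N: "\<forall>j\<ge>N. L2_sq (g j) < d + \<epsilon>" using ev[OF \<open>\<epsilon> > 0\<close>] by blast
    have "\<forall>x\<in>UNIV. \<forall>m\<ge>N. \<forall>n\<ge>N. dist (g m x) (g n x) < e"
      unfolding dist_norm using N g(1) \<epsilon> by simp
    then show "\<exists>N. \<forall>x\<in>UNIV. \<forall>m\<ge>N. \<forall>n\<ge>N. dist (g m x) (g n x) < e" ..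
  qed
  from Cauchy_uniformly_convergent[OF this]
  obtain \<psi> where \<psi>: "uniform_limit UNIV g \<psi> sequentially" by (auto simp: uniformly_convergent_on_def)
  have g_lim: "(\<lambda>j. g j x) \<longlonglongrightarrow> \<psi> x" for x using tendsto_uniform_limitI[OF \<psi>] by simp
  have cont: "continuous_on UNIV u" if "u \<in> ?A" for u
    using test_function_in_ballD(4)[OF test_function_in_ball_rotation_averages[OF \<phi> that]] .
  have inv: "\<psi> (T *v x) = \<psi> x" if T: "rotation_matrix T" for T x
  proof -
    have "(\<lambda>j. g j (T *v x) - g j x) \<longlonglongrightarrow> 0"
    proof (rule tendstoI)
      fix e :: real assume "e > 0"
      obtain \<epsilon> where "\<epsilon> > 0" and \<epsilon>: "\<forall>u\<in>?A. \<forall>v\<in>?A. L2_sq u < d + \<epsilon> \<longrightarrow> L2_sq v < d + \<epsilon> \<longrightarrow> (\<forall>x. norm (u x - v x) < e)"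
        using near_minimal_rotation_averages_close[OF \<phi> \<open>e > 0\<close> d] by blast
      obtain N where N: "\<forall>j\<ge>N. L2_sq (g j) < d + \<epsilon>" using ev[OF \<open>\<epsilon> > 0\<close>] by blast
      have "norm (g j (T *v x) - g j x) < e" if "j \<ge> N" for j
        using bspec[OF bspec[OF \<epsilon> rotation_averages_rotated[OF g(1) T]] g(1), of j j] N that
          L2_sq_compose_orthogonal[OF rotation_matrix_facts(1)[OF T] cont[OF g(1)], of j]
        by simp
      then show "\<forall>\<^sub>F j in sequentially. dist (g j (T *v x) - g j x) 0 < e"
        unfolding eventually_sequentially by auto
    qed
    moreover have "(\<lambda>j. g j (T *v x) - g j x) \<longlonglongrightarrow> \<psi> (T *v x) - \<psi> x"
      by (intro tendsto_diff g_lim)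
    ultimately have "\<psi> (T *v x) - \<psi> x = 0" by (rule LIMSEQ_unique[symmetric])
    then show ?thesis by simp
  qed
  have radial: "\<psi> y = \<psi> x" if eq: "norm y = norm x" for x y
  proof -
    obtain f where f: "orthogonal_transformation f" "det (matrix f) = 1" "f x = y"
      by (rule rotation_exists[OF assms(1) eq[symmetric]])
    then have "rotation_matrix (matrix f)"
      by (simp add: rotation_matrix_def orthogonal_transformation_matrix)
    from inv[OF this, of x] show ?thesis
      using f by (simp add: orthogonal_transformation_linear matrix_works)
  qed
  have cont_\<psi>: "continuous_on UNIV \<psi>"
    by (rule uniform_limit_theorem[OF _ \<psi>]) (use cont g(1) in auto)
  have "\<psi> x = spherical_mean \<phi> x" for x
  proof -
    have "(\<lambda>j. spherical_mean (g j) x) \<longlonglongrightarrow> spherical_mean \<psi> x"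
    proof (rule tendstoI)
      fix e :: real assume "e > 0"
      then have "\<forall>\<^sub>F j in sequentially. \<forall>y\<in>UNIV. dist (g j y) (\<psi> y) < e / 2"
        by (intro uniform_limitD[OF \<psi>]) simp
      then show "\<forall>\<^sub>F j in sequentially. dist (spherical_mean (g j) x) (spherical_mean \<psi> x) < e"
      proof eventually_elim
        case (elim j)
        have "norm (spherical_mean (\<lambda>y. g j y - \<psi> y) x) \<le> e / 2"
          using elim by (intro norm_spherical_mean_le continuous_intros cont_\<psi> cont[OF g(1)]) (auto simp: dist_norm less_imp_le)
        then show ?case
          using spherical_mean_lincomb[OF cont[OF g(1)[of j]] cont_\<psi>, of 1 "-1"] \<open>e > 0\<close> by (simp add: dist_norm)
      qed
    qed
    then have "spherical_mean \<phi> x = spherical_mean \<psi> x"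
      unfolding spherical_mean_rotation_averages[OF \<phi> g(1)] using LIMSEQ_unique tendsto_const by blast
    also have "\<dots> = \<psi> x" by (rule spherical_mean_of_radial) (rule radial)
    finally show ?thesis by simp
  qed
  then have "\<psi> = spherical_mean \<phi>" by blast
  then show thesis using that g(1) \<psi> by blast
qed

section \<open>Rotation invariant ultradistributions\<close>

lemma test_step_cball_iff:
  fixes \<phi> :: "real^'n \<Rightarrow> complex"
  assumes "\<And>p. M p > 0" "h > 0"
  shows "\<phi> \<in> test_step M h (cball 0 R) \<longleftrightarrow> (\<exists>C. test_function_in_ball R (\<lambda>k. C * (h ^ k * M k)) \<phi>)"
  unfolding test_step_iff[OF closed_cball assms] test_function_in_ball_def by blast

lemma rotation_averages_in_test_step:
  fixes \<phi> :: "real^'n \<Rightarrow> complex"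
  assumes M: "\<And>p. M p > 0" and "h > 0" "\<phi> \<in> test_step M h (cball 0 R)" "u \<in> rotation_averages \<phi>"
  shows "u \<in> test_step M (real CARD('n) * h) (cball 0 R)"
proof -
  obtain C where "test_function_in_ball R (\<lambda>k. C * (h ^ k * M k)) \<phi>"
    using assms(3) unfolding test_step_cball_iff[OF M \<open>h > 0\<close>] ..
  from test_function_in_ball_rotation_averages[OF this assms(4)]
  have "test_function_in_ball R (\<lambda>k. C * ((real CARD('n) * h) ^ k * M k)) u"
    by (simp add: power_mult_distrib mult_ac)
  moreover have "real CARD('n) * h > 0" using \<open>h > 0\<close> by simp
  ultimately show ?thesis using test_step_cball_iff[where M = M, OF M] by blast
qed

lemma rotation_averages_in_test_space:
  fixes \<phi> :: "real^'n \<Rightarrow> complex"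
  assumes M: "\<And>p. M p > 0" and "\<phi> \<in> test_space c M" "u \<in> rotation_averages \<phi>"
  shows "u \<in> test_space c M"
proof -
  obtain R where R: "R > 0" "for_step_parameters c (\<lambda>h. \<phi> \<in> test_step M h (cball 0 R))"
    using assms(2) unfolding test_space_eq[OF M] by blast
  have "for_step_parameters c (\<lambda>h. u \<in> test_step M h (cball 0 R))"
    by (rule for_step_parameters_scale[OF R(2), of "real CARD('n)"])
      (use rotation_averages_in_test_step[OF M _ _ assms(3)] in auto)
  then show ?thesis using R(1) unfolding test_space_eq[OF M] by blast
qed

lemma test_space_scale:
  fixes \<phi> :: "real^'n \<Rightarrow> complex"
  assumes M: "\<And>p. M p > 0" and \<phi>: "\<phi> \<in> test_space c M"
  shows "(\<lambda>x. a * \<phi> x) \<in> test_space c M"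
proof -
  obtain R where R: "R > 0" "for_step_parameters c (\<lambda>h. \<phi> \<in> test_step M h (cball 0 R))"
    using \<phi> unfolding test_space_eq[OF M] by blast
  have "for_step_parameters c (\<lambda>h. (\<lambda>x. a * \<phi> x) \<in> test_step M h (cball 0 R))"
    using R(2)
  proof (rule for_step_parameters_mono)
    fix h :: real assume h: "h > 0" "\<phi> \<in> test_step M h (cball 0 R)"
    show "(\<lambda>x. a * \<phi> x) \<in> test_step M h (cball 0 R)"
      using test_step_lincomb[where M = M, OF closed_cball M h(1,2,2), of a 0] by simp
  qed
  then show ?thesis using R(1) unfolding test_space_eq[OF M] by blast
qed

lemma uniform_limit_rotation_averages:
  fixes \<phi> \<psi> :: "real^'n \<Rightarrow> complex"
  assumes \<phi>: "test_function_in_ball R b \<phi>" and g: "\<And>j. g j \<in> rotation_averages \<phi>"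
    and lim: "uniform_limit UNIV g \<psi> sequentially"
  shows "test_function_in_ball R (\<lambda>k. real CARD('n) ^ k * b k) \<psi>"
    and "uniform_limit UNIV (\<lambda>j. fold partial_deriv is (g j)) (fold partial_deriv is \<psi>) sequentially"
proof -
  note t = test_function_in_ball_rotation_averages[OF \<phi> g]
  have bound: "norm (fold partial_deriv is (g j) x) \<le> real CARD('n) ^ length is * b (length is)" for j "is" x
    by (rule derivs_bounded_byD[OF test_function_in_ballD(2)[OF t]])
  note smooth_lim = smooth_fun_uniform_limit[where b = "\<lambda>k. real CARD('n) ^ k * b k",
    OF test_function_in_ballD(1)[OF t] bound lim]
  show l: "uniform_limit UNIV (\<lambda>j. fold partial_deriv is (g j)) (fold partial_deriv is \<psi>) sequentially" for "is"
    by (rule smooth_lim(2))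
  have "norm (fold partial_deriv is \<psi> x) \<le> real CARD('n) ^ length is * b (length is)" for "is" x
    by (rule LIMSEQ_le_const2[OF tendsto_norm[OF tendsto_uniform_limitI[OF l UNIV_I]]]) (use bound in blast)
  moreover have "\<psi> x = 0" if "x \<notin> cball 0 R" for x
    using tendsto_uniform_limitI[OF lim, of x] test_function_in_ballD(3)[OF t that] by (simp add: LIMSEQ_const_iff)
  ultimately show "test_function_in_ball R (\<lambda>k. real CARD('n) ^ k * b k) \<psi>"
    using smooth_lim(1) unfolding test_function_in_ball_def derivs_bounded_by_def by blast
qed

text \<open>With \<open>2 * h\<close> in place of \<open>h\<close> the weights gain a factor \<open>2 ^ k\<close>, which beats the constant \<open>C / e\<close> for all large
orders \<open>k\<close>. The finitely many remaining derivatives converge uniformly.\<close>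

lemma eventually_derivs_bounded_by:
  fixes u :: "nat \<Rightarrow> real^'n \<Rightarrow> complex"
  assumes M: "\<And>p. M p > 0" and "h > 0" "e > 0"
    and bound: "\<And>j. derivs_bounded_by (\<lambda>k. C * (h ^ k * M k)) (u j)"
    and lim: "\<And>is. uniform_limit UNIV (\<lambda>j. fold partial_deriv is (u j)) (\<lambda>_. 0) sequentially"
  shows "\<forall>\<^sub>F j in sequentially. derivs_bounded_by (\<lambda>k. e * ((2 * h) ^ k * M k)) (u j)"
proof -
  obtain N where N: "C / e < 2 ^ N" using real_arch_pow[of 2 "C / e"] by auto
  have "\<forall>\<^sub>F j in sequentially. \<forall>is\<in>{is :: 'n list. length is \<le> N}. \<forall>x\<in>UNIV.
      dist (fold partial_deriv is (u j) x) 0 < e * ((2 * h) ^ length is * M (length is))"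
  proof (rule eventually_ball_finite)
    show "finite {is :: 'n list. length is \<le> N}"
      using finite_lists_length_le[of "UNIV :: 'n set" N] by simp
    show "\<forall>is\<in>{is :: 'n list. length is \<le> N}. \<forall>\<^sub>F j in sequentially. \<forall>x\<in>UNIV.
      dist (fold partial_deriv is (u j) x) 0 < e * ((2 * h) ^ length is * M (length is))"
      using M \<open>h > 0\<close> \<open>e > 0\<close> by (intro ballI uniform_limitD[OF lim]) simp
  qed
  then show ?thesis
  proof eventually_elim
    case (elim j)
    show ?case
      unfolding derivs_bounded_by_def
    proof (intro allI)
      fix "is" :: "'n list" and x
      show "norm (fold partial_deriv is (u j) x) \<le> e * ((2 * h) ^ length is * M (length is))"
      proof (cases "length is \<le> N")
        case True
        then show ?thesis using elim by (simp add: less_imp_le)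
      next
        case False
        then have "(2 :: real) ^ N \<le> 2 ^ length is" by (intro power_increasing) auto
        then have "e * 2 ^ N \<le> e * 2 ^ length is" using \<open>e > 0\<close> by simp
        moreover have "C < e * 2 ^ N" using N \<open>e > 0\<close> by (simp add: field_simps)
        ultimately have "C \<le> e * 2 ^ length is" by linarith
        then have "C * (h ^ length is * M (length is)) \<le> e * 2 ^ length is * (h ^ length is * M (length is))"
          using M[of "length is"] \<open>h > 0\<close> by (intro mult_right_mono) auto
        then show ?thesis
          using derivs_bounded_byD[OF bound[of j], of "is" x] by (simp add: power_mult_distrib mult_ac)
      qed
    qed
  qed
qed

text \<open>The averages and their limit obey the bounds of the step of parameter \<open>n h\<close> with one constant; doubling
the parameter turns uniform convergence of each derivative into convergence in norm.\<close>

lemma test_null_sequence_rotation_averages: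
  fixes \<phi> \<psi> :: "real^'n \<Rightarrow> complex"
  assumes M: "\<And>p. M p > 0" and \<phi>: "for_step_parameters c (\<lambda>h. \<phi> \<in> test_step M h (cball 0 R))"
    and g: "\<And>j. g j \<in> rotation_averages \<phi>" and lim: "uniform_limit UNIV g \<psi> sequentially"
  shows "for_step_parameters c (\<lambda>h. \<psi> \<in> test_step M h (cball 0 R))"
    and "test_null_sequence c M (cball 0 R) (\<lambda>j x. g j x - \<psi> x)"
proof -
  let ?n = "real CARD('n)"
  have step: "\<psi> \<in> test_step M (?n * h) (cball 0 R) \<and>
      (\<forall>j. (\<lambda>x. g j x - \<psi> x) \<in> test_step M (2 * (?n * h)) (cball 0 R)) \<and>
      (\<forall>e>0. \<forall>\<^sub>F j in sequentially. derivs_bounded_by (\<lambda>k. e * ((2 * (?n * h)) ^ k * M k)) (\<lambda>x. g j x - \<psi> x))"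
    if h: "h > 0" "\<phi> \<in> test_step M h (cball 0 R)" for h
  proof -
    have nh: "?n * h > 0" using h(1) by simp
    obtain C where C: "test_function_in_ball R (\<lambda>k. C * (h ^ k * M k)) \<phi>"
      using h(2) unfolding test_step_cball_iff[OF M h(1)] ..
    have b: "?n ^ k * (C * (h ^ k * M k)) = C * ((?n * h) ^ k * M k)" for k
      by (simp add: power_mult_distrib)
    have \<psi>: "test_function_in_ball R (\<lambda>k. C * ((?n * h) ^ k * M k)) \<psi>"
      using uniform_limit_rotation_averages(1)[OF C g lim] unfolding b .
    have g': "test_function_in_ball R (\<lambda>k. C * ((?n * h) ^ k * M k)) (g j)" for j
      using test_function_in_ball_rotation_averages[OF C g[of j]] unfolding b .
    have diff: "test_function_in_ball R (\<lambda>k. (2 * C) * ((?n * h) ^ k * M k)) (\<lambda>x. g j x - \<psi> x)" for j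
      using test_function_in_ball_diff[OF g' \<psi>, of j] by (simp only: mult.assoc)
    have "uniform_limit UNIV (\<lambda>j. fold partial_deriv is (\<lambda>x. g j x - \<psi> x)) (\<lambda>_. 0) sequentially" for "is"
      using uniform_limit_rotation_averages(2)[OF C g lim, of "is"]
        fold_partial_deriv_diff[OF test_function_in_ballD(1)[OF g'] test_function_in_ballD(1)[OF \<psi>]]
      by (simp add: uniform_limit_iff dist_norm)
    then have "\<forall>\<^sub>F j in sequentially. derivs_bounded_by (\<lambda>k. e * ((2 * (?n * h)) ^ k * M k)) (\<lambda>x. g j x - \<psi> x)"
      if "e > 0" for e
      by (intro eventually_derivs_bounded_by[OF M nh that test_function_in_ballD(2)[OF diff]])
    moreover have "\<psi> \<in> test_step M (?n * h) (cball 0 R)"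
      using \<psi> test_step_cball_iff[where M = M, OF M nh] by blast
    moreover have "(\<lambda>x. g j x - \<psi> x) \<in> test_step M (2 * (?n * h)) (cball 0 R)" for j
    proof -
      have "(\<lambda>x. g j x - \<psi> x) \<in> test_step M (?n * h) (cball 0 R)"
        using diff[of j] test_step_cball_iff[where M = M, OF M nh] by blast
      moreover have "?n * h \<le> 2 * (?n * h)" using h(1) by simp
      ultimately show ?thesis
        using test_step_mono[where M = M, OF closed_cball closed_cball order_refl M nh] by blast
    qed
    ultimately show ?thesis by blast
  qed
  show "for_step_parameters c (\<lambda>h. \<psi> \<in> test_step M h (cball 0 R))"
    by (rule for_step_parameters_scale[OF \<phi>, of ?n]) (use step in auto)
  show "test_null_sequence c M (cball 0 R) (\<lambda>j x. g j x - \<psi> x)"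
    unfolding test_null_sequence_def
    by (rule for_step_parameters_scale[OF \<phi>, of "2 * ?n"]) (use step in \<open>auto simp: mult.assoc\<close>)
qed

text \<open>A rotation invariant \<open>f\<close> has the value \<open>f \<phi>\<close> at all averages, and by continuity also at their limit.\<close>

lemma ultradistribution_spherical_mean:
  fixes f :: "(real^'n \<Rightarrow> complex) \<Rightarrow> complex"
  assumes "CARD('n) \<ge> 2" and M: "\<And>p. M p > 0" and f: "f \<in> ultradistributions c M"
    and inv: "rotation_invariant c M f" and \<phi>: "\<phi> \<in> test_space c M"
  shows "f (spherical_mean \<phi>) = f \<phi>"
proof -
  have add: "f (\<lambda>x. u x + v x) = f u + f v" if "u \<in> test_space c M" "v \<in> test_space c M" for u v
    using f that by (auto simp: ultradistributions_def)
  have scale: "f (\<lambda>x. a * u x) = a * f u" if "u \<in> test_space c M" for u a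
    using f that by (auto simp: ultradistributions_def)
  obtain R where R: "R > 0" "for_step_parameters c (\<lambda>h. \<phi> \<in> test_step M h (cball 0 R))"
    using \<phi> unfolding test_space_eq[OF M] by blast
  obtain h where h: "h > 0" "\<phi> \<in> test_step M h (cball 0 R)"
    using for_step_parameters_exists[OF R(2)] by blast
  obtain C where C: "test_function_in_ball R (\<lambda>k. C * (h ^ k * M k)) \<phi>"
    using h(2) unfolding test_step_cball_iff[OF M h(1)] ..
  obtain g where g: "\<And>j. g j \<in> rotation_averages \<phi>" "uniform_limit UNIV g (spherical_mean \<phi>) sequentially"
    by (rule rotation_averages_approximate_spherical_mean[OF assms(1) C]) (rule that; blast)
  have avg: "f u = f \<phi>" if "u \<in> rotation_averages \<phi>" for u
    using that
  proof induction
    case (rotated T)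
    have "f \<phi> = f (\<lambda>x. \<phi> (matrix_inv (transpose T) *v x))"
      using inv \<phi> rotation_matrix_facts(3)[OF rotated] unfolding rotation_invariant_def by blast
    then show ?case
      by (simp add: rotation_matrix_facts(2)[OF rotation_matrix_facts(3)[OF rotated]])
  next
    case (midpoint u v)
    have uv: "u \<in> test_space c M" "v \<in> test_space c M"
      using midpoint.hyps rotation_averages_in_test_space[OF M \<phi>] by blast+
    have "f (\<lambda>x. 1/2 * u x + 1/2 * v x) = 1/2 * f u + 1/2 * f v"
      using add[OF test_space_scale[OF M uv(1)] test_space_scale[OF M uv(2)], of "1/2" "1/2"]
      unfolding scale[OF uv(1)] scale[OF uv(2)] .
    then show ?case using midpoint.IH by simp
  qed
  note null = test_null_sequence_rotation_averages[OF M R(2) g]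
  have mean: "spherical_mean \<phi> \<in> test_space c M"
    using null(1) R(1) unfolding test_space_eq[OF M] by blast
  have diff: "(\<lambda>x. g j x - spherical_mean \<phi> x) \<in> test_space c M" for j
  proof -
    have "for_step_parameters c (\<lambda>h. (\<lambda>x. g j x - spherical_mean \<phi> x) \<in> test_step M h (cball 0 R))"
      using null(2) unfolding test_null_sequence_def by (rule for_step_parameters_mono) blast
    then show ?thesis using R(1) unfolding test_space_eq[OF M] by blast
  qed
  have "(\<lambda>j. f (\<lambda>x. g j x - spherical_mean \<phi> x)) \<longlonglongrightarrow> 0"
    by (rule ultradistribution_tendsto_0[OF M f R(1) null(2)])
  moreover have "f (\<lambda>x. g j x - spherical_mean \<phi> x) = f \<phi> - f (spherical_mean \<phi>)" for j
    using add[OF diff[of j] mean] avg[OF g(1)[of j]] by (simp add: algebra_simps)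
  ultimately show ?thesis by (simp add: LIMSEQ_const_iff)
qed

text \<open>The equation \<open>f = f\<^sub>S\<close> only speaks about test functions, so it can be used at a rotated test function
because the latter is a test function again.\<close>

lemma rotation_invariant_if_eq_spherical_mean_dual:
  fixes f :: "(real^'n \<Rightarrow> complex) \<Rightarrow> complex"
  assumes M: "\<And>p. M p > 0" and eq: "f = spherical_mean_dual c M f"
  shows "rotation_invariant c M f"
  unfolding rotation_invariant_def
proof (intro allI impI ballI)
  fix T :: "real^'n^'n" and \<phi> :: "real^'n \<Rightarrow> complex"
  assume T: "rotation_matrix T" and \<phi>: "\<phi> \<in> test_space c M"
  define S where "S = matrix_inv T"
  have S: "rotation_matrix S" unfolding S_def rotation_matrix_facts(2)[OF T] by (rule rotation_matrix_facts(3)[OF T])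
  have mem: "(\<lambda>x. \<phi> (S *v x)) \<in> test_space c M"
    by (rule rotation_averages_in_test_space[OF M \<phi> rotated[OF S]])
  obtain R h where h: "h > 0" "\<phi> \<in> test_step M h (cball 0 R)"
    using \<phi> for_step_parameters_exists unfolding test_space_eq[OF M] by blast
  have cont: "continuous_on UNIV \<phi>"
    using h(2) by (intro smooth_fun_imp_continuous_on) (simp add: test_step_def)
  have dual: "f u = f (spherical_mean u)" if "u \<in> test_space c M" for u
    using that eq unfolding spherical_mean_dual_def by (metis restrict_apply')
  have "f \<phi> = f (spherical_mean (\<lambda>x. \<phi> (S *v x)))"
    unfolding spherical_mean_compose_orthogonal[OF rotation_matrix_facts(1)[OF S] cont] by (rule dual[OF \<phi>])
  also have "\<dots> = f (\<lambda>x. \<phi> (S *v x))" by (rule dual[OF mem, symmetric])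
  finally show "f \<phi> = f (\<lambda>x. \<phi> (matrix_inv T *v x))" by (simp add: S_def)
qed

theorem theorem4:
  fixes M :: "nat \<Rightarrow> real" and c :: ultra_class and f :: "(real^'n \<Rightarrow> complex) \<Rightarrow> complex"
  assumes "CARD('n) \<ge> 2"
    and "\<forall>p. M p > 0" and "M 0 = 1"
    and "log_convex_seq M" and "derivation_stable_seq M" and "non_quasianalytic_seq M"
    and "f \<in> ultradistributions c M"
  shows "rotation_invariant c M f \<longleftrightarrow> f = spherical_mean_dual c M f"
proof
  have M: "M p > 0" for p using assms(2) by blast
  show "rotation_invariant c M f" if "f = spherical_mean_dual c M f"
    by (rule rotation_invariant_if_eq_spherical_mean_dual[OF M that])
  assume inv: "rotation_invariant c M f"
  show "f = spherical_mean_dual c M f"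
  proof
    fix \<phi>
    show "f \<phi> = spherical_mean_dual c M f \<phi>"
    proof (cases "\<phi> \<in> test_space c M")
      case True
      then show ?thesis
        using ultradistribution_spherical_mean[OF assms(1) M assms(7) inv] by (simp add: spherical_mean_dual_def)
    next
      case False
      then show ?thesis
        using assms(7) by (simp add: spherical_mean_dual_def ultradistributions_def extensional_def)
    qed
  qed
qed

end
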